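(* Let $m$, $t$ and $a$ be positive integers with $m=\binom{t-1}{3}+\binom{t-2}{2}+a$, where $1\le a\le t-2$. Let $G=([t],E)$ be a left-compressed $3$-graph on the vertex set $[t]$ with $m$ edges satisfying $|E_{(t-1)t}|\le \frac{2t+3a-4}{5}$. If $G$ contains a clique of order $t-1$, then $\lambda(G)\le\lambda(C_{3,m})$.
   Context: A $3$-graph $G$ on vertex set $[t]=\{1,\dots,t\}$ has an edge set $E$ of $3$-element subsets of $[t]$; an edge $\{a,b,c\}$ is written $abc$. For vertices $i,j$, $E_{ij}=\{k\in[t]: \{i,j,k\}\in E\}$. $G$ is left-compressed if whenever $j_1j_2j_3\in E$ and $i_1,i_2,i_3$ are distinct with $i_p\le j_p$ for $p=1,2,3$, then $i_1i_2i_3\in E$. A clique of order $s$ is a set of $s$ vertices all of whose $3$-subsets are edges. For $\vec x\in\mathbb R^n$, $\lambda(G,\vec x)=\sum_{ijk\in E}x_ix_jx_k$, and the Lagrangian is $\lambda(G)=\max\{\lambda(G,\vec x):\sum_i x_i=1,\ x_i\ge0\}$. $C_{3,m}$ denotes the $3$-graph whose edges are the first $m$ sets in the colex ordering of $\mathbb N^{(3)}$ (the $3$-subsets of positive integers), where for distinct $A,B$, $A<B$ iff $\max(A\triangle B)\in B$; e.g. $123<124<134<234<125<\cdots$. *)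

theory Defs
  imports "HOL-Analysis.Analysis"
begin

definition three_graph :: "'a set \<Rightarrow> 'a set set \<Rightarrow> bool" where
  "three_graph V E \<longleftrightarrow> finite V \<and> E \<subseteq> {e. e \<subseteq> V \<and> card e = 3}"

definition pair_link :: "'a set \<Rightarrow> 'a set set \<Rightarrow> 'a \<Rightarrow> 'a \<Rightarrow> 'a set" where
  "pair_link V E i j = {k \<in> V. {i, j, k} \<in> E}"

definition has_clique :: "'a set \<Rightarrow> 'a set set \<Rightarrow> nat \<Rightarrow> bool" where
  "has_clique V E s \<longleftrightarrow>
     (\<exists>S. S \<subseteq> V \<and> finite S \<and> card S = s \<and> (\<forall>e. e \<subseteq> S \<and> card e = 3 \<longrightarrow> e \<in> E))"

definition left_compressed :: "nat set \<Rightarrow> nat set set \<Rightarrow> bool" where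
  "left_compressed V E \<longleftrightarrow>
     (\<forall>j1 j2 j3 i1 i2 i3.
        {j1, j2, j3} \<in> E \<and> card {j1, j2, j3} = 3 \<and>
        i1 \<in> V \<and> i2 \<in> V \<and> i3 \<in> V \<and> i1 \<noteq> i2 \<and> i1 \<noteq> i3 \<and> i2 \<noteq> i3 \<and>
        i1 \<le> j1 \<and> i2 \<le> j2 \<and> i3 \<le> j3 \<longrightarrow> {i1, i2, i3} \<in> E)"

definition lagrange_poly :: "'a set set \<Rightarrow> ('a \<Rightarrow> real) \<Rightarrow> real" where
  "lagrange_poly E x = (\<Sum>e\<in>E. \<Prod>i\<in>e. x i)"

text \<open>Only the values of a weighting on the vertex set matter; weightings are total
  functions whose values outside \<open>V\<close> are left unconstrained.\<close>

definition weightings :: "'a set \<Rightarrow> ('a \<Rightarrow> real) set" where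
  "weightings V = {x. (\<forall>i\<in>V. 0 \<le> x i) \<and> (\<Sum>i\<in>V. x i) = 1}"

text \<open>The supremum is a maximum for every 3-graph with nonempty vertex set: see
  \<open>lagrangian_attained\<close> and \<open>lagrangian_upper\<close> below.\<close>

definition lagrangian :: "'a set \<Rightarrow> 'a set set \<Rightarrow> real" where
  "lagrangian V E = (SUP x\<in>weightings V. lagrange_poly E x)"

definition colex_less :: "nat set \<Rightarrow> nat set \<Rightarrow> bool" where
  "colex_less A B \<longleftrightarrow> A \<noteq> B \<and> Max (sym_diff A B) \<in> B"

definition pos_triples :: "nat set set" where
  "pos_triples = {A. A \<subseteq> {1..} \<and> card A = 3}"

text \<open>A triple is among the first \<open>m\<close> iff it has fewer than \<open>m\<close> predecessors.\<close>

definition colex_edges :: "nat \<Rightarrow> nat set set" where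
  "colex_edges m = {A \<in> pos_triples. card {B \<in> pos_triples. colex_less B A} < m}"

text \<open>The vertex set of \<open>C\<^bsub>3,m\<^esub>\<close> is taken to be the set of vertices covered by its edges;
  isolated vertices do not affect the Lagrangian.\<close>

definition colex_vertices :: "nat \<Rightarrow> nat set" where
  "colex_vertices m = \<Union> (colex_edges m)"

lemma lagrangian_max_exists:
  assumes "three_graph V E" "V \<noteq> {}"
  shows "\<exists>x\<in>weightings V. \<forall>y\<in>weightings V. lagrange_poly E y \<le> lagrange_poly E x"
proof -
  have fin: "finite V" and sub: "\<And>e. e \<in> E \<Longrightarrow> e \<subseteq> V"
    using assms(1) by (auto simp: three_graph_def)
  define P where "P = (\<Pi>\<^sub>E i\<in>UNIV. if i \<in> V then {0..1::real} else {0})"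
  define K where "K = P \<inter> {x. (\<Sum>i\<in>V. x i) = 1}"
  have "compactin (product_topology (\<lambda>i. euclidean) UNIV) P"
    unfolding P_def by (subst compactin_PiE) auto
  then have "compact P"
    by (simp add: euclidean_product_topology)
  moreover have "closed {x::'a \<Rightarrow> real. (\<Sum>i\<in>V. x i) = 1}"
    by (intro closed_Collect_eq continuous_intros continuous_on_product_coordinates)
  ultimately have "compact K"
    unfolding K_def by (rule compact_Int_closed)
  obtain v where v: "v \<in> V" using assms(2) by auto
  have "(\<lambda>i. if i = v then 1 else 0) \<in> K"
    using v fin by (auto simp: K_def P_def PiE_def)
  then have "K \<noteq> {}" by auto
  have "continuous_on K (lagrange_poly E)"
    unfolding lagrange_poly_def
    by (intro continuous_intros continuous_on_subset[OF continuous_on_product_coordinates]) auto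
  then obtain x where x: "x \<in> K" "\<And>y. y \<in> K \<Longrightarrow> lagrange_poly E y \<le> lagrange_poly E x"
    using continuous_attains_sup[OF \<open>compact K\<close> \<open>K \<noteq> {}\<close>] by blast
  have "x \<in> weightings V"
    using x(1) by (force simp: K_def P_def weightings_def PiE_def Pi_def split: if_splits)
  moreover have "lagrange_poly E y \<le> lagrange_poly E x" if y: "y \<in> weightings V" for y
  proof -
    define z where "z = (\<lambda>i. if i \<in> V then y i else 0)"
    have "y i \<le> 1" if "i \<in> V" for i
      using member_le_sum[of i V y] y fin that by (auto simp: weightings_def)
    moreover have "(\<Sum>i\<in>V. z i) = 1"
      using y by (simp add: z_def weightings_def)
    ultimately have "z \<in> K"
      using y by (auto simp: K_def P_def z_def weightings_def PiE_def)
    moreover have "lagrange_poly E y = lagrange_poly E z"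
      unfolding lagrange_poly_def z_def
      using sub by (intro sum.cong prod.cong) auto
    ultimately show ?thesis using x(2) by simp
  qed
  ultimately show ?thesis by blast
qed

lemma lagrangian_attained:
  assumes "three_graph V E" "V \<noteq> {}"
  shows "\<exists>x\<in>weightings V. lagrangian V E = lagrange_poly E x"
proof -
  obtain x where x: "x \<in> weightings V"
    "\<And>y. y \<in> weightings V \<Longrightarrow> lagrange_poly E y \<le> lagrange_poly E x"
    using lagrangian_max_exists[OF assms] by blast
  then have "lagrangian V E = lagrange_poly E x"
    unfolding lagrangian_def by (intro cSup_eq_maximum) auto
  with x(1) show ?thesis by blast
qed

lemma lagrangian_upper:
  assumes "three_graph V E" "x \<in> weightings V"
  shows "lagrange_poly E x \<le> lagrangian V E"
proof -
  have "V \<noteq> {}" using assms(2) by (auto simp: weightings_def)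
  then obtain z where "\<And>y. y \<in> weightings V \<Longrightarrow> lagrange_poly E y \<le> lagrange_poly E z"
    using lagrangian_max_exists[OF assms(1)] by blast
  then have "bdd_above (lagrange_poly E ` weightings V)"
    by (intro bdd_aboveI[of _ "lagrange_poly E z"]) auto
  then show ?thesis
    unfolding lagrangian_def using assms(2) by (intro cSUP_upper)
qed

lemma colex_less_imp_encode_less:
  assumes "finite A" "finite B" "colex_less A B"
  shows "(\<Sum>i\<in>A. 2 ^ i) < (\<Sum>i\<in>B. 2 ^ i :: nat)"
proof -
  define k where "k = Max (sym_diff A B)"
  have ne: "sym_diff A B \<noteq> {}" and fin: "finite (sym_diff A B)" and kB: "k \<in> B"
    using assms by (auto simp: colex_less_def k_def)
  have "k \<in> sym_diff A B" unfolding k_def using ne fin by (rule Max_in[rotated])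
  then have kA: "k \<notin> A" using kB by auto
  have above: "i \<in> A \<longleftrightarrow> i \<in> B" if "k < i" for i
    using that Max_ge[OF fin, of i] unfolding k_def by (auto simp: not_le[symmetric])
  have split: "A = {i\<in>A. k < i} \<union> {i\<in>A. i < k}"
    using kA by (auto simp: not_less order_le_less)
  have "(\<Sum>i\<in>A. 2 ^ i) = (\<Sum>i\<in>{i\<in>A. k < i}. 2 ^ i) + (\<Sum>i\<in>{i\<in>A. i < k}. 2 ^ i :: nat)"
    by (subst split, rule sum.union_disjoint) (use assms in auto)
  also have "(\<Sum>i\<in>{i\<in>A. i < k}. 2 ^ i :: nat) \<le> (\<Sum>i<k. 2 ^ i)"
    by (rule sum_mono2) auto
  also have "(\<Sum>i<k. 2 ^ i :: nat) < 2 ^ k"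
    using sum_power2[of k] by (simp add: lessThan_atLeast0)
  also have "{i\<in>A. k < i} = {i\<in>B. k < i}" using above by auto
  also have "(\<Sum>i\<in>{i\<in>B. k < i}. 2 ^ i) + 2 ^ k = (\<Sum>i\<in>insert k {i\<in>B. k < i}. 2 ^ i :: nat)"
    using assms by simp
  also have "\<dots> \<le> (\<Sum>i\<in>B. 2 ^ i)"
    by (rule sum_mono2) (use assms kB in auto)
  finally show ?thesis by simp
qed

lemma colex_less_linear:
  assumes "finite A" "finite B" "A \<noteq> B"
  shows "colex_less A B \<or> colex_less B A"
proof -
  have "Max (sym_diff A B) \<in> sym_diff A B"
    by (rule Max_in) (use assms in auto)
  then show ?thesis
    using assms(3) by (auto simp: colex_less_def Un_commute)
qed

lemma colex_less_iff_encode: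
  assumes "finite A" "finite B"
  shows "colex_less A B \<longleftrightarrow> (\<Sum>i\<in>A. 2 ^ i) < (\<Sum>i\<in>B. 2 ^ i :: nat)"
proof
  assume "(\<Sum>i\<in>A. 2 ^ i) < (\<Sum>i\<in>B. 2 ^ i :: nat)"
  then show "colex_less A B"
    using colex_less_linear[OF assms] colex_less_imp_encode_less[OF assms(2,1)] by force
qed (rule colex_less_imp_encode_less[OF assms])

lemma card_colex_edges: "card (colex_edges m) = m"
proof -
  define f :: "nat set \<Rightarrow> nat" where "f = (\<lambda>A. \<Sum>i\<in>A. 2 ^ i)"
  define T where "T = f ` pos_triples"
  have fin: "finite A" if "A \<in> pos_triples" for A
    using that by (auto simp: pos_triples_def intro: card_ge_0_finite)
  have less: "colex_less A B \<longleftrightarrow> f A < f B" if "A \<in> pos_triples" "B \<in> pos_triples" for A B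
    using that colex_less_iff_encode fin by (simp add: f_def)
  have inj: "inj_on f pos_triples"
    by (rule inj_onI) (metis less fin colex_less_linear less_irrefl)
  have "inj (\<lambda>n::nat. {1, 2, n + 3})"
    by (rule injI) (auto simp: doubleton_eq_iff insert_eq_iff)
  moreover have "range (\<lambda>n::nat. {1, 2, n + 3}) \<subseteq> pos_triples"
    by (auto simp: pos_triples_def)
  ultimately have "infinite pos_triples"
    by (metis finite_subset finite_imageD infinite_UNIV_nat)
  then have inf: "infinite T"
    using inj finite_imageD by (auto simp: T_def)
  have rank: "card {y\<in>T. y < enumerate T n} = n" for n
  proof -
    have "{y\<in>T. y < enumerate T n} = enumerate T ` {..<n}"
    proof (intro equalityI subsetI)
      fix y assume y: "y \<in> {y\<in>T. y < enumerate T n}"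
      then obtain k where "y = enumerate T k" using enumerate_Ex inf by auto
      then show "y \<in> enumerate T ` {..<n}"
        using y enumerate_mono_iff[OF inf] by auto
    next
      fix y assume "y \<in> enumerate T ` {..<n}"
      then show "y \<in> {y\<in>T. y < enumerate T n}"
        using enumerate_mono_iff[OF inf] enumerate_in_set[OF inf] by auto
    qed
    then show ?thesis
      using strict_mono_enumerate[OF inf]
      by (simp add: card_image strict_mono_imp_inj_on inj_on_subset[OF _ subset_UNIV])
  qed
  have pre: "card {B \<in> pos_triples. colex_less B A} = card {y\<in>T. y < f A}"
    if A: "A \<in> pos_triples" for A
  proof -
    have "{y\<in>T. y < f A} = f ` {B \<in> pos_triples. colex_less B A}"
      using A less by (auto simp: T_def)
    then show ?thesis
      using inj by (simp add: card_image inj_on_subset)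
  qed
  have "f ` colex_edges m = {y\<in>T. card {z\<in>T. z < y} < m}"
    unfolding colex_edges_def using pre by (force simp: T_def)
  also have "\<dots> = enumerate T ` {..<m}"
  proof (intro equalityI subsetI)
    fix y assume y: "y \<in> {y\<in>T. card {z\<in>T. z < y} < m}"
    then obtain k where "y = enumerate T k" using enumerate_Ex inf by auto
    then show "y \<in> enumerate T ` {..<m}"
      using y rank by auto
  next
    fix y assume "y \<in> enumerate T ` {..<m}"
    then show "y \<in> {y\<in>T. card {z\<in>T. z < y} < m}"
      using rank enumerate_in_set[OF inf] by auto
  qed
  finally have "card (f ` colex_edges m) = m"
    using strict_mono_enumerate[OF inf]
    by (simp add: card_image strict_mono_imp_inj_on inj_on_subset[OF _ subset_UNIV])
  moreover have "inj_on f (colex_edges m)"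
    using inj by (rule inj_on_subset) (auto simp: colex_edges_def)
  ultimately show ?thesis by (simp add: card_image)
qed

lemma three_graph_colex:
  "three_graph (colex_vertices m) (colex_edges m)"
proof -
  have "finite (colex_edges m)"
    using card_colex_edges[of m]
    by (cases "m = 0") (auto simp: colex_edges_def intro: card_ge_0_finite)
  moreover have "finite A" if "A \<in> colex_edges m" for A
    using that by (auto simp: colex_edges_def pos_triples_def intro: card_ge_0_finite)
  ultimately have "finite (colex_vertices m)"
    by (auto simp: colex_vertices_def)
  then show ?thesis
    by (auto simp: three_graph_def colex_vertices_def colex_edges_def pos_triples_def)
qed

end

(* Left-compression makes {1..t-1} a clique, so E is the complete 3-graph minus triples {u,v,t}:
   those containing t-1, namely {l,t-1,t} with l > b, and c = b - a others, the "gaps" {u,v} within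
   {1..t-2}. The hypothesis on b says 3c <= 2(t-2-b). If there is no gap, E is the colex initial
   segment. Otherwise pick a minimal gap {j,k} and switch: insert {j,k,t}, delete {b,t-1,t}. This
   keeps E left-compressed and lowers c by one, so it suffices that the Lagrangian does not decrease.
   At an optimal x with x_1 >= ... >= x_t the vector e_j + e_k - e_{t-1} - e_b is a stationary
   direction, and moving along it by the step s that is optimal for the switched graph changes the
   value by -s^2 (2-S-x_t) + s x_t S + x_t (x_j x_k - x_b x_{t-1}), S = x_b + x_j + x_k + x_{t-1}.
   The Lagrange conditions bound the last term. *)
theory Submission
  imports Defs
begin

section \<open>Sums over small subsets\<close>

text \<open>The bare switch can lose \<open>x t * (x b * x (t-1) - x j * x k)\<close>; at an optimum
  the shift repays this at no first-order cost. Its direction has entries 0, 1 and -1 with sum 0, so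
  the cubic term drops out. Among its four vertices exactly the pairs inside
  \<open>{j, k, t-1}\<close> are missing, so the quadratic term is explicit. The best
  \<open>s\<close> recovers \<open>(x t * S)^2 / (4 * B)\<close> with
  \<open>B = 2 - S - x t\<close>, and everything reduces to one inequality in five weights.
  Stationarity reads \<open>(x b - x l) * (1 - x b - x l) = x t * D l\<close>, where
  \<open>D l\<close> is the weight of the vertices that form a nonedge with \<open>l\<close> and
  \<open>t\<close>. If \<open>j\<close> lies in a single gap, the relation for \<open>j\<close>
  suffices. Otherwise \<open>D j\<close> and \<open>D k\<close> may be large, and the counterweight
  is \<open>D (t-1)\<close>, the weight of all vertices strictly between \<open>b\<close> and
  \<open>t-1\<close>. Here the factor 2/3 in the bound on \<open>c\<close> enters: the gaps forced
  by \<open>{j, k}\<close> leave at least twice as many vertices between \<open>b\<close> and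
  \<open>j\<close> as \<open>{j..t-2}\<close> has besides \<open>j\<close> and
  \<open>k\<close>.\<close>

lemma sum_prod_subsets_insert:
  fixes x :: "'a \<Rightarrow> 'b::comm_ring_1"
  assumes "finite V" "a \<notin> V"
  shows "(\<Sum>e | e \<subseteq> insert a V \<and> card e = Suc n. prod x e)
       = (\<Sum>e | e \<subseteq> V \<and> card e = Suc n. prod x e) + x a * (\<Sum>e | e \<subseteq> V \<and> card e = n. prod x e)"
proof -
  have fin: "finite e" if "e \<subseteq> V" for e using that assms finite_subset by auto
  have "{e. e \<subseteq> insert a V \<and> card e = Suc n}
      = {e. e \<subseteq> V \<and> card e = Suc n} \<union> insert a ` {e. e \<subseteq> V \<and> card e = n}" (is "?L = ?A \<union> ?B")
  proof (intro equalityI subsetI)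
    fix e assume e: "e \<in> ?L"
    show "e \<in> ?A \<union> ?B"
    proof (cases "a \<in> e")
      case True
      then have "e = insert a (e - {a})" "e - {a} \<subseteq> V" "card (e - {a}) = n" using e by auto
      then show ?thesis by blast
    qed (use e in auto)
  next
    fix e assume "e \<in> ?A \<union> ?B"
    then show "e \<in> ?L" using fin assms by (auto simp: card_insert_if)
  qed
  moreover have "inj_on (insert a) {e. e \<subseteq> V \<and> card e = n}"
    using assms by (auto intro!: inj_onI simp: insert_ident subset_iff)
  moreover have "?A \<inter> ?B = {}" using assms by auto
  moreover have "(\<Sum>e\<in>{e. e \<subseteq> V \<and> card e = n}. prod x (insert a e)) = (\<Sum>e\<in>{e. e \<subseteq> V \<and> card e = n}. x a * prod x e)"
    using assms fin by (intro sum.cong refl prod.insert) auto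
  ultimately show ?thesis
    using assms by (simp add: sum.union_disjoint sum.reindex sum_distrib_left)
qed

lemma sum_prod_subsets_1:
  fixes x :: "'a \<Rightarrow> 'b::comm_ring_1"
  assumes "finite V"
  shows "(\<Sum>e | e \<subseteq> V \<and> card e = 1. prod x e) = sum x V"
  using assms
proof (induction V)
  case empty
  then show ?case by (simp cong: conj_cong)
next
  case (insert a V)
  have "{e. e \<subseteq> V \<and> card e = 0} = {{}}"
    using insert(1) by (auto dest: finite_subset)
  then show ?case
    using insert sum_prod_subsets_insert[of V a x 0] by simp
qed

lemma sum_prod_subsets_2:
  fixes x :: "'a \<Rightarrow> 'b::comm_ring_1"
  assumes "finite V"
  shows "2 * (\<Sum>e | e \<subseteq> V \<and> card e = 2. prod x e) = (sum x V)\<^sup>2 - (\<Sum>i\<in>V. (x i)\<^sup>2)"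
  using assms
proof (induction V)
  case empty
  then show ?case by (simp cong: conj_cong)
next
  case (insert a V)
  then show ?case
    using sum_prod_subsets_insert[of V a x 1] sum_prod_subsets_1[of V x]
    by (simp add: numeral_2_eq_2[symmetric] algebra_simps power2_eq_square)
qed

text \<open>Newton's identity \<open>6 e_3 = p_1^3 - 3 p_1 p_2 + 2 p_3\<close>, by adding one vertex
  at a time. It trades a sum over triples for power sums, which are easy to expand along a
  line.\<close>

lemma sum_prod_subsets_3:
  fixes x :: "'a \<Rightarrow> 'b::comm_ring_1"
  assumes "finite V"
  shows "6 * (\<Sum>e | e \<subseteq> V \<and> card e = 3. prod x e)
       = (sum x V)^3 - 3 * sum x V * (\<Sum>i\<in>V. (x i)\<^sup>2) + 2 * (\<Sum>i\<in>V. (x i)^3)"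
  using assms
proof (induction V)
  case empty
  then show ?case by (simp cong: conj_cong)
next
  case (insert a V)
  have "6 * (\<Sum>e | e \<subseteq> insert a V \<and> card e = 3. prod x e)
    = 6 * (\<Sum>e | e \<subseteq> V \<and> card e = 3. prod x e) + 3 * x a * (2 * (\<Sum>e | e \<subseteq> V \<and> card e = 2. prod x e))"
    using insert sum_prod_subsets_insert[of V a x 2]
    by (simp add: numeral_3_eq_3[symmetric] algebra_simps)
  then show ?case
    unfolding sum_prod_subsets_2[OF insert(1)] insert(3)
    using insert by (simp add: algebra_simps power2_eq_square power3_eq_cube)
qed

text \<open>Each pair is met in both orders, hence the factor 2. This passes between nonedges as
  sets and nonedges as a quadratic form.\<close>

lemma sum_pairs_eq_sum_prod:
  fixes x :: "'a \<Rightarrow> 'b::comm_ring_1"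
  assumes "finite V" "H \<subseteq> {e. e \<subseteq> V \<and> card e = 2}"
  shows "(\<Sum>j\<in>V. \<Sum>k\<in>V. of_bool ({j,k} \<in> H) * x j * x k) = 2 * (\<Sum>h\<in>H. prod x h)"
proof -
  have "finite H" using assms by (auto intro: finite_subset[of _ "Pow V"])
  then show ?thesis using assms(2)
  proof (induction H)
    case (insert h H)
    then obtain u v where h: "h = {u,v}" "u \<noteq> v" "u \<in> V" "v \<in> V"
      by (auto simp: card_2_iff)
    have "of_bool ({j,k} \<in> insert h H) * x j * x k = of_bool ({j,k} \<in> H) * x j * x k +
       (of_bool (j = u) * (of_bool (k = v) * (x j * x k)) + of_bool (j = v) * (of_bool (k = u) * (x j * x k)))" for j k
      using insert(2) h(1,2) by (auto simp: doubleton_eq_iff insert_commute)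
    then show ?case
      using insert h assms(1)
      by (simp add: sum.distrib flip: sum_distrib_left) 
  qed auto
qed

section \<open>Sorted optimal weightings\<close>

text \<open>Only edges containing exactly one of \<open>i\<close>, \<open>j\<close> feel the swap,
  and it changes the value by \<open>(x j - x i)\<close> times the difference of the sums over the
  links \<open>A i\<close> and \<open>A j\<close>. Left-compression gives
  \<open>A j \<subseteq> A i\<close>.\<close>

lemma lagrange_poly_swap_le:
  fixes x :: "nat \<Rightarrow> real"
  assumes graph: "three_graph V E" and lc: "left_compressed V E"
    and ij: "i \<in> V" "j \<in> V" "i < j" "x i < x j" and nn: "\<And>l. l \<in> V \<Longrightarrow> 0 \<le> x l"
  shows "lagrange_poly E x \<le> lagrange_poly E (x \<circ> Transposition.transpose i j)"
proof -
  have finE: "finite E"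
    using graph by (auto simp: three_graph_def intro: finite_subset[of _ "Pow V"])
  have ed: "e \<subseteq> V" "card e = 3" "finite e" if "e \<in> E" for e
    using graph that by (auto simp: three_graph_def intro: finite_subset)
  define z where "z = x \<circ> Transposition.transpose i j"
  define A where "A k = {f. i \<notin> f \<and> j \<notin> f \<and> insert k f \<in> E}" for k
  define R where "R = {e\<in>E. (i \<in> e) = (j \<in> e)}"
  have finA: "finite (A k)" for k
    using ed finE by (intro finite_subset[of "A k" "Pow (\<Union>E)"]) (auto simp: A_def)
  have fin_f: "finite f" if "f \<in> A k" for f k
    using that ed(3)[of "insert k f"] by (auto simp: A_def)
  have BA: "A j \<subseteq> A i"
  proof
    fix f assume f: "f \<in> A j"
    then have fe: "insert j f \<in> E" "i \<notin> f" "j \<notin> f" by (auto simp: A_def)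
    then have "card f = 2" using ed(2)[OF fe(1)] fin_f[OF f] by simp
    then obtain u v where uv: "f = {u,v}" "u \<noteq> v" by (auto simp: card_2_iff)
    then have "{j,u,v} \<in> E" "card {j,u,v} = 3" "u \<in> V" "v \<in> V" using fe ed[OF fe(1)] by auto
    then have "{i,u,v} \<in> E"
      using lc[unfolded left_compressed_def, rule_format, of j u v i u v] ij fe uv by auto
    then show "f \<in> A i" using uv fe by (auto simp: A_def)
  qed
  have E: "E = R \<union> (insert i ` A i \<union> insert j ` A j)"
  proof (intro equalityI subsetI)
    fix e assume e: "e \<in> E"
    consider "e \<in> R" | "i \<in> e" "j \<notin> e" | "i \<notin> e" "j \<in> e" using e by (auto simp: R_def)
    then show "e \<in> R \<union> (insert i ` A i \<union> insert j ` A j)"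
    proof cases
      case 2
      then have "e = insert i (e - {i})" "e - {i} \<in> A i" using e by (auto simp: A_def insert_absorb)
      then show ?thesis by blast
    next
      case 3
      then have "e = insert j (e - {j})" "e - {j} \<in> A j" using e by (auto simp: A_def insert_absorb)
      then show ?thesis by blast
    qed simp
  qed (auto simp: R_def A_def)
  have inj: "inj_on (insert k) (A k)" if "k \<in> {i,j}" for k
    by (rule inj_onI, subst (asm) insert_ident) (use that in \<open>auto simp: A_def\<close>)
  have decomp: "lagrange_poly E y = lagrange_poly R y + y i * (\<Sum>f\<in>A i. prod y f) + y j * (\<Sum>f\<in>A j. prod y f)" for y
  proof -
    have "lagrange_poly E y = lagrange_poly R y
        + ((\<Sum>f\<in>A i. prod y (insert i f)) + (\<Sum>f\<in>A j. prod y (insert j f)))"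
    proof -
      let ?P = "insert i ` A i" and ?Q = "insert j ` A j"
      have "sum (prod y) E = sum (prod y) R + sum (prod y) (?P \<union> ?Q)"
        by (subst E, rule sum.union_disjoint) (use finE finA ij in \<open>auto simp: R_def A_def\<close>)
      moreover have "sum (prod y) (?P \<union> ?Q) = sum (prod y) ?P + sum (prod y) ?Q"
        by (rule sum.union_disjoint) (use finA ij in \<open>auto simp: A_def\<close>)
      ultimately show ?thesis by (simp add: lagrange_poly_def sum.reindex inj)
    qed
    moreover have "prod y (insert k f) = y k * prod y f" if "f \<in> A k" "k \<in> {i,j}" for k f
      using that fin_f by (intro prod.insert) (auto simp: A_def)
    ultimately show ?thesis by (simp add: sum_distrib_left)
  qed
  have zA: "prod z f = prod x f" if "f \<in> A k" for f k
    using that by (intro prod.cong) (auto simp: A_def z_def Transposition.transpose_def)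
  have zR: "prod z e = prod x e" if "e \<in> R" for e
  proof -
    have "bij_betw (Transposition.transpose i j) e e"
      using that by (intro bij_betw_byWitness[where f' = "Transposition.transpose i j"]) (auto simp: R_def Transposition.transpose_def)
    then show ?thesis unfolding z_def comp_def by (rule prod.reindex_bij_betw)
  qed
  have "lagrange_poly E z = lagrange_poly R x + x j * (\<Sum>f\<in>A i. prod x f) + x i * (\<Sum>f\<in>A j. prod x f)"
    unfolding decomp using zA zR by (simp add: lagrange_poly_def z_def)
  then have "lagrange_poly E z - lagrange_poly E x = (x j - x i) * ((\<Sum>f\<in>A i. prod x f) - (\<Sum>f\<in>A j. prod x f))"
    unfolding decomp[of x] by (simp add: algebra_simps)
  moreover have "(\<Sum>f\<in>A j. prod x f) \<le> (\<Sum>f\<in>A i. prod x f)"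
  proof (rule sum_mono2[OF finA BA])
    fix f assume "f \<in> A i - A j"
    then have "f \<subseteq> V" using ed(1) by (auto simp: A_def)
    then show "0 \<le> prod x f" using nn by (intro prod_nonneg) auto
  qed
  ultimately have "lagrange_poly E z - lagrange_poly E x \<ge> 0" using ij by simp
  then show ?thesis by (simp add: z_def)
qed

text \<open>Among the optimal rearrangements of one optimum, the one minimizing \<open>\<Sum>i. i * x i\<close> is sorted,
  since swapping an inversion preserves optimality.\<close>

lemma sorted_optimum_exists:
  fixes V :: "nat set"
  assumes graph: "three_graph V E" and lc: "left_compressed V E" and "V \<noteq> {}"
  obtains x where "x \<in> weightings V" "\<And>y. y \<in> weightings V \<Longrightarrow> lagrange_poly E y \<le> lagrange_poly E x"
    "\<And>i j. i \<in> V \<Longrightarrow> j \<in> V \<Longrightarrow> i < j \<Longrightarrow> x j \<le> x i"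
proof -
  have finV: "finite V" using graph by (simp add: three_graph_def)
  obtain x where x: "x \<in> weightings V" "\<And>y. y \<in> weightings V \<Longrightarrow> lagrange_poly E y \<le> lagrange_poly E x"
    using lagrangian_max_exists[OF graph assms(3)] by blast
  define P where "P = {p. p permutes V \<and> lagrange_poly E (x \<circ> p) = lagrange_poly E x}"
  define f where "f p = (\<Sum>i\<in>V. real i * x (p i))" for p
  have "finite P" using finite_permutations[OF finV] by (simp add: P_def)
  moreover have "id \<in> P" by (simp add: P_def permutes_id)
  ultimately obtain p where p: "p \<in> P" "\<And>p'. p' \<in> P \<Longrightarrow> f p \<le> f p'"
    using ex_min_if_finite[of "f ` P"] by (metis (no_types, lifting) empty_iff finite_imageI imageE image_eqI not_le)
  have perm_w: "x \<circ> q \<in> weightings V" if "q permutes V" for q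
    using x(1) sum.permute[OF that, of x] permutes_in_image[OF that] by (auto simp: weightings_def)
  define y where "y = x \<circ> p"
  have pV: "p permutes V" and py: "lagrange_poly E y = lagrange_poly E x" using p by (auto simp: P_def y_def)
  have yw: "y \<in> weightings V" using perm_w[OF pV] by (simp add: y_def)
  show thesis
  proof (rule that[of y])
    show "y j \<le> y i" if ij: "i \<in> V" "j \<in> V" "i < j" for i j
    proof (rule ccontr)
      assume "\<not> y j \<le> y i"
      then have lt: "y i < y j" by simp
      have perm: "(p \<circ> Transposition.transpose i j) permutes V"
        using permutes_compose[OF permutes_swap_id[OF ij(1,2)] pV] .
      have "lagrange_poly E y \<le> lagrange_poly E (y \<circ> Transposition.transpose i j)"
        using lagrange_poly_swap_le[OF graph lc ij lt] yw by (auto simp: weightings_def)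
      moreover have "lagrange_poly E (y \<circ> Transposition.transpose i j) \<le> lagrange_poly E x"
        using x(2)[OF perm_w[OF perm]] by (simp add: y_def comp_assoc)
      ultimately have "p \<circ> Transposition.transpose i j \<in> P"
        using perm py by (simp add: P_def y_def comp_assoc)
      from p(2)[OF this] have le: "f p \<le> f (p \<circ> Transposition.transpose i j)" .
      have split: "V = insert i (insert j (V - {i,j}))" using ij by auto
      have "f p = real i * y i + (real j * y j + (\<Sum>l\<in>V-{i,j}. real l * y l))"
        unfolding f_def by (subst split) (use ij finV in \<open>simp add: y_def\<close>)
      moreover have "f (p \<circ> Transposition.transpose i j) = real i * y j + (real j * y i + (\<Sum>l\<in>V-{i,j}. real l * y l))"
        unfolding f_def by (subst split) (use ij finV in \<open>simp add: y_def\<close>)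
      ultimately have "(real j - real i) * (y j - y i) \<le> 0" using le by (simp add: algebra_simps)
      then show False using ij lt by (simp add: mult_le_0_iff)
    qed
  qed (use yw py x in auto)
qed

section \<open>Perturbing a weighting\<close>

text \<open>The clique is normalised to \<open>{1..<t}\<close>, as \<open>clique_initial\<close>
  permits. Every nonedge then contains \<open>t\<close> and is described by a pair of smaller
  vertices.\<close>

locale compressed_clique =
  fixes t :: nat and E :: "nat set set"
  assumes t3: "t \<ge> 3"
    and graph: "three_graph {1..t} E"
    and compressed: "left_compressed {1..t} E"
    and clique: "\<And>e. e \<subseteq> {1..<t} \<Longrightarrow> card e = 3 \<Longrightarrow> e \<in> E"
begin

text \<open>Real-valued, symmetric and with zero diagonal, so that it is the matrix of a quadratic
  form.\<close>

definition missing :: "nat \<Rightarrow> nat \<Rightarrow> real" where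
  "missing j k = of_bool (j \<noteq> k \<and> {j, k, t} \<notin> E)"

text \<open>Since \<open>\<Sum>i. x i = 1\<close>, Newton's identity turns the complete part of the polynomial into
  \<open>1/6 - (\<Sum>i. x i ^ 2) / 2 + (\<Sum>i. x i ^ 3) / 3\<close>, whose partial derivatives are \<open>x l ^ 2 - x l\<close>.\<close>

definition grad :: "(nat \<Rightarrow> real) \<Rightarrow> nat \<Rightarrow> real" where
  "grad x l = (x l)\<^sup>2 - x l - x t * (\<Sum>k\<in>{1..<t}. missing l k * x k)"

lemma edgeD: "e \<in> E \<Longrightarrow> e \<subseteq> {1..t} \<and> card e = 3"
  using graph by (auto simp: three_graph_def)

lemma finite_E: "finite E"
  by (rule finite_subset[of _ "Pow {1..t}"]) (use edgeD in auto)

lemma vertices_eq: "{1..t} = insert t {1..<t}"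
  using t3 by auto

lemma missing_sym: "missing j k = missing k j"
  by (auto simp: missing_def insert_commute)

lemma sum_split_last: "sum f {1..t} = f t + sum f {1..<t}" for f :: "nat \<Rightarrow> real"
  by (subst vertices_eq, subst sum.insert) auto

text \<open>The complete polynomial minus the nonedges. By the clique each nonedge is
  \<open>insert t h\<close> for a pair \<open>h\<close>, and the double sum counts \<open>h\<close>
  twice.\<close>

lemma lagrange_poly_eq:
  assumes "sum x {1..t} = 1"
  shows "lagrange_poly E x = 1/6 - (\<Sum>i\<in>{1..t}. (x i)\<^sup>2) / 2 + (\<Sum>i\<in>{1..t}. (x i)^3) / 3
     - x t * (\<Sum>j\<in>{1..<t}. \<Sum>k\<in>{1..<t}. missing j k * x j * x k) / 2"
proof -
  define T where "T = {e. e \<subseteq> {1..t} \<and> card e = 3}"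
  define H where "H = {h. h \<subseteq> {1..<t} \<and> card h = 2 \<and> insert t h \<notin> E}"
  have finT: "finite T" by (auto simp: T_def intro: finite_subset[of _ "Pow {1..t}"])
  have finh: "finite h" if "h \<in> H" for h using that by (auto simp: H_def intro: finite_subset)
  have TE: "T - E = insert t ` H"
  proof (intro equalityI subsetI)
    fix e assume e: "e \<in> T - E"
    then have "\<not> e \<subseteq> {1..<t}" "e \<subseteq> insert t {1..<t}"
      using clique[of e] unfolding T_def vertices_eq by auto
    then have "t \<in> e" by blast
    then have eq: "insert t (e - {t}) = e" by blast
    have "e - {t} \<subseteq> {1..<t}" using e unfolding T_def vertices_eq by blast
    moreover have "card (e - {t}) = 2" using e \<open>t \<in> e\<close> by (simp add: T_def)
    ultimately have "e - {t} \<in> H" using e eq by (simp add: H_def)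
    with eq show "e \<in> insert t ` H" by (metis image_eqI)
  next
    fix e assume "e \<in> insert t ` H"
    then obtain h where h: "h \<in> H" "e = insert t h" by blast
    then have "t \<notin> h" "h \<subseteq> {1..<t}" by (auto simp: H_def)
    moreover from this have "insert t h \<subseteq> {1..t}" unfolding vertices_eq by blast
    ultimately show "e \<in> T - E" using h finh[OF h(1)] by (auto simp: T_def H_def)
  qed
  have "lagrange_poly T x = lagrange_poly E x + lagrange_poly (T - E) x"
    unfolding lagrange_poly_def using finT edgeD
    by (subst sum.subset_diff[of E T]) (auto simp: T_def)
  moreover have "6 * lagrange_poly T x = 1 - 3 * (\<Sum>i\<in>{1..t}. (x i)\<^sup>2) + 2 * (\<Sum>i\<in>{1..t}. (x i)^3)"
    using sum_prod_subsets_3[of "{1..t}" x] unfolding lagrange_poly_def T_def assms by simp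
  moreover have "lagrange_poly (T - E) x = x t * (\<Sum>h\<in>H. prod x h)"
  proof -
    have "inj_on (insert t) H"
      by (rule inj_onI) (metis (no_types, lifting) H_def atLeastLessThan_iff insert_ident less_irrefl mem_Collect_eq subset_iff)
    moreover have "prod x (insert t h) = x t * prod x h" if h: "h \<in> H" for h
    proof -
      have "t \<notin> h" using h by (auto simp: H_def)
      then show ?thesis using finh[OF h] by simp
    qed
    ultimately show ?thesis
      unfolding lagrange_poly_def TE by (simp add: sum.reindex sum_distrib_left)
  qed
  moreover have Q: "(\<Sum>j\<in>{1..<t}. \<Sum>k\<in>{1..<t}. missing j k * x j * x k) = 2 * (\<Sum>h\<in>H. prod x h)"
  proof -
    have "2 * (\<Sum>h\<in>H. prod x h) = (\<Sum>j\<in>{1..<t}. \<Sum>k\<in>{1..<t}. of_bool ({j,k} \<in> H) * x j * x k)"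
      by (rule sum_pairs_eq_sum_prod[symmetric]) (auto simp: H_def)
    also have "\<dots> = (\<Sum>j\<in>{1..<t}. \<Sum>k\<in>{1..<t}. missing j k * x j * x k)"
      by (intro sum.cong refl) (auto simp: H_def missing_def card_insert_if insert_commute)
    finally show ?thesis ..
  qed
  ultimately show ?thesis unfolding Q by (simp add: field_simps)
qed

text \<open>An exact expansion. \<open>lagrange_poly_eq\<close> holds only for total weight 1, which
  the zero sum of \<open>v\<close> preserves; \<open>v t = 0\<close> keeps the nonedge term
  quadratic in \<open>s\<close>.\<close>

lemma lagrange_poly_expand:
  assumes x: "sum x {1..t} = 1" and v: "sum v {1..<t} = 0" and vt: "v t = 0"
  shows "lagrange_poly E (\<lambda>l. x l + s * v l) = lagrange_poly E x
     + s * (\<Sum>l\<in>{1..<t}. v l * grad x l)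
     + s\<^sup>2 * ((\<Sum>l\<in>{1..<t}. (v l)\<^sup>2 * (x l - 1/2))
        - x t * (\<Sum>j\<in>{1..<t}. \<Sum>k\<in>{1..<t}. missing j k * v j * v k) / 2)
     + s^3 * (\<Sum>l\<in>{1..<t}. (v l)^3) / 3"
proof -
  let ?V = "{1..<t}"
  define Q where "Q x y = (\<Sum>j\<in>?V. \<Sum>k\<in>?V. missing j k * x j * y k)" for x y :: "nat \<Rightarrow> real"
  have "sum (\<lambda>l. x l + s * v l) {1..t} = 1"
    using x v vt by (simp add: sum_split_last sum.distrib del: One_nat_def flip: sum_distrib_left)
  note eq = lagrange_poly_eq[OF this] lagrange_poly_eq[OF x]
  have Qsym: "Q x v = Q v x"
    unfolding Q_def by (subst sum.swap) (simp add: missing_sym mult_ac)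
  have "Q (\<lambda>l. x l + s * v l) (\<lambda>l. x l + s * v l) = Q x x + s * Q x v + s * Q v x + s\<^sup>2 * Q v v"
    unfolding Q_def
    by (simp add: algebra_simps power2_eq_square sum.distrib sum_distrib_left)
  then have Q: "Q (\<lambda>l. x l + s * v l) (\<lambda>l. x l + s * v l) = Q x x + 2 * s * Q v x + s\<^sup>2 * Q v v"
    by (simp add: Qsym)
  have s2: "(\<Sum>l\<in>{1..t}. (x l + s * v l)\<^sup>2)
      = (\<Sum>l\<in>{1..t}. (x l)\<^sup>2) + 2 * s * (\<Sum>l\<in>?V. v l * x l) + s\<^sup>2 * (\<Sum>l\<in>?V. (v l)\<^sup>2)"
    by (simp add: sum_split_last vt algebra_simps power2_eq_square sum.distrib sum_distrib_left del: One_nat_def)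
  have s3: "(\<Sum>l\<in>{1..t}. (x l + s * v l)^3)
      = (\<Sum>l\<in>{1..t}. (x l)^3) + 3 * s * (\<Sum>l\<in>?V. v l * (x l)\<^sup>2)
        + 3 * s\<^sup>2 * (\<Sum>l\<in>?V. (v l)\<^sup>2 * x l) + s^3 * (\<Sum>l\<in>?V. (v l)^3)"
    by (simp add: sum_split_last vt algebra_simps power2_eq_square power3_eq_cube sum.distrib sum_distrib_left del: One_nat_def)
  have g: "(\<Sum>l\<in>?V. v l * grad x l)
      = (\<Sum>l\<in>?V. v l * (x l)\<^sup>2) - (\<Sum>l\<in>?V. v l * x l) - x t * Q v x"
    by (simp add: grad_def Q_def algebra_simps sum.distrib sum_subtractf sum_distrib_left)
  have h: "(\<Sum>l\<in>?V. (v l)\<^sup>2 * (x l - 1/2)) = (\<Sum>l\<in>?V. (v l)\<^sup>2 * x l) - (\<Sum>l\<in>?V. (v l)\<^sup>2) / 2"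
    by (simp add: algebra_simps sum_subtractf sum_divide_distrib)
  show ?thesis
    unfolding eq Q_def[symmetric] s2 s3 g h Q vt by (simp add: field_simps)
qed

text \<open>Otherwise moving a little weight from \<open>i\<close> to \<open>j\<close> would
  increase the value, the linear gain beating the quadratic term. Applied in both directions it
  gives equal partial derivatives at vertices of positive weight.\<close>

lemma grad_le_of_optimal:
  assumes x: "x \<in> weightings {1..t}"
    and opt: "\<And>y. y \<in> weightings {1..t} \<Longrightarrow> lagrange_poly E y \<le> lagrange_poly E x"
    and ij: "i \<in> {1..<t}" "j \<in> {1..<t}" "i \<noteq> j" "x i > 0"
  shows "grad x j \<le> grad x i"
proof (rule ccontr)
  assume "\<not> ?thesis"
  then have D: "grad x j - grad x i > 0" by simp
  define v :: "nat \<Rightarrow> real" where "v = (\<lambda>l. of_bool (l = j) - of_bool (l = i))"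
  define C where "C = (\<Sum>l\<in>{1..<t}. (v l)\<^sup>2 * (x l - 1/2))
        - x t * (\<Sum>j\<in>{1..<t}. \<Sum>k\<in>{1..<t}. missing j k * v j * v k) / 2"
  have vt: "v t = 0" using ij by (auto simp: v_def)
  have v: "sum v {1..<t} = 0" using ij by (simp add: v_def sum_subtractf)
  have v3: "(\<Sum>l\<in>{1..<t}. (v l)^3) = 0"
  proof -
    have "(v l)^3 = v l" for l using ij by (auto simp: v_def)
    then show ?thesis using v by simp
  qed
  have g: "(\<Sum>l\<in>{1..<t}. v l * grad x l) = grad x j - grad x i"
    using ij by (simp add: v_def algebra_simps sum_subtractf)
  have x1: "sum x {1..t} = 1" and x0: "\<And>l. l \<in> {1..t} \<Longrightarrow> 0 \<le> x l" using x by (auto simp: weightings_def)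
  \<comment> \<open>The first bound keeps the weight at \<open>i\<close> nonnegative; the second
    keeps \<open>s * \<bar>C\<bar>\<close> below half the linear coefficient, with
    \<open>+ 1\<close> guarding against \<open>C = 0\<close>.\<close>
  define s where "s = min (x i) ((grad x j - grad x i) / (2 * (\<bar>C\<bar> + 1)))"
  have s: "0 < s" "s \<le> x i" using D ij by (auto simp: s_def)
  have "s * (2 * (\<bar>C\<bar> + 1)) \<le> grad x j - grad x i"
    by (simp add: s_def pos_le_divide_eq[symmetric] add_nonneg_pos)
  moreover have "s * \<bar>C\<bar> \<le> s * (2 * (\<bar>C\<bar> + 1)) - s" using s by (simp add: algebra_simps)
  ultimately have sC: "s * \<bar>C\<bar> < grad x j - grad x i" using s by linarith
  have "(\<lambda>l. x l + s * v l) \<in> weightings {1..t}"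
  proof -
    have "0 \<le> x l + s * v l" if "l \<in> {1..t}" for l
      using x0[OF that] s ij by (auto simp: v_def)
    moreover have "(\<Sum>l\<in>{1..t}. x l + s * v l) = 1"
      using x1 v vt by (simp add: sum_split_last sum.distrib del: One_nat_def flip: sum_distrib_left)
    ultimately show ?thesis by (simp add: weightings_def)
  qed
  from opt[OF this] have "s * (grad x j - grad x i) + s\<^sup>2 * C \<le> 0"
    unfolding lagrange_poly_expand[OF x1 v vt] v3 g C_def by simp
  then have "s * ((grad x j - grad x i) + s * C) \<le> 0" by (simp add: algebra_simps power2_eq_square)
  then have "(grad x j - grad x i) + s * C \<le> 0" using s by (simp add: mult_le_0_iff)
  moreover have "s * C \<ge> - (s * \<bar>C\<bar>)" using s mult_left_mono[of "-\<bar>C\<bar>" C s] by simp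
  ultimately show False using sC by simp
qed

end

section \<open>Polynomial inequalities behind the exchange\<close>

text \<open>Here \<open>p\<close>, \<open>y\<close>, \<open>z\<close>, \<open>q\<close>,
  \<open>W\<close> stand for the weights of \<open>b\<close>, \<open>j\<close>, \<open>k\<close>,
  \<open>t-1\<close>, \<open>t\<close>, and \<open>st\<close> is stationarity at \<open>j\<close>
  with \<open>D j \<le> q + z\<close>. After \<open>p*q - y*z \<le> q * (p - y)\<close>, multiplying
  by \<open>1 - p - y\<close> makes \<open>st\<close> applicable.\<close>

lemma exchange_ineq_one_gap:
  fixes p y z q W :: real
  assumes "0 < W" "W \<le> q" "q \<le> z" "z \<le> y" "y \<le> p" and S: "p + y + z + q + W \<le> 1"
    and st: "(p - y) * (1 - p - y) \<le> W * (q + z)"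
  shows "4 * (p*q - y*z) * (2 - (p+y+z+q) - W) \<le> W * (p+y+z+q)^2"
proof -
  define B where "B = 2 - (p+y+z+q) - W"
  define P where "P = p + y"
  have B: "B > 0" and R: "1 - p - y > 0" using assms by (auto simp: B_def)
  have "p*q - y*z \<le> q * (p - y)"
    using mult_left_mono[of q z y] assms by (simp add: algebra_simps)
  then have "4 * (p*q - y*z) * B * (1-p-y) \<le> 4 * (q * (p-y)) * B * (1-p-y)"
    using B R by (intro mult_right_mono) auto
  also have "\<dots> = 4 * q * B * ((p-y) * (1-p-y))" by (simp add: algebra_simps)
  also have "\<dots> \<le> 4 * q * B * (W * (q+z))"
    using B assms by (intro mult_left_mono st) auto
  also have "\<dots> = W * (4 * (q+z)) * (q * B)" by (simp add: algebra_simps)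
  also have "\<dots> \<le> W * (4 * (q+z)) * (P * (1-p-y))"
  proof (intro mult_left_mono)
    \<comment> \<open>Expanding gives \<open>P * (1 - P) \<ge> q * (2 - P - 2*q)\<close>, and
      \<open>q * B\<close> is at most the right-hand side because \<open>z \<ge> q\<close>.\<close>
    have "(P - 2*q) * (1 - q - P) \<ge> 0" 
      using assms by (intro mult_nonneg_nonneg) (auto simp: P_def)
    moreover have "q * z \<ge> q * q" "q * W \<ge> 0" using assms by (auto intro: mult_left_mono)
    ultimately show "q * B \<le> P * (1-p-y)"
      by (simp add: B_def P_def algebra_simps)
  qed (use assms in auto)
  also have "\<dots> = W * (4 * (q+z) * P) * (1-p-y)" by (simp add: algebra_simps)
  also have "\<dots> \<le> W * (p+y+z+q)^2 * (1-p-y)"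
  proof (intro mult_right_mono mult_left_mono)
    show "4 * (q+z) * P \<le> (p+y+z+q)^2"
      using zero_le_power2[of "P - (q+z)"] by (simp add: P_def power2_eq_square algebra_simps)
  qed (use assms R in auto)
  finally show ?thesis using R unfolding B_def by simp
qed

text \<open>The stationarity relations at \<open>j\<close> and \<open>k\<close> are added and that
  at \<open>t-1\<close> subtracted, so only \<open>Dy + Dz - D\<close> has to be small. With
  \<alpha> = \<open>p-y\<close>, \<beta> = \<open>p-z\<close>, \<gamma> = \<open>p-q\<close>, the
  target \<open>p*q - y*z\<close> is \<open>p * (\<close>\<alpha> + \<beta> -
  \<gamma>\<open>)\<close> - \<alpha>\<beta>.\<close>

lemma exchange_ineq_many_gaps:
  fixes p y z q W Dy Dz D :: real
  assumes "0 < W" "W \<le> q" "q \<le> z" "z \<le> y" "y \<le> p" and S: "p + y + z + q + W \<le> 1"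
    and sty: "(p - y) * (1 - p - y) \<le> W * Dy"
    and stz: "(p - z) * (1 - p - z) \<le> W * Dz"
    and stq: "W * D \<le> (p - q) * (1 - p - q)"
    and D: "Dy + Dz - D \<le> q"
  shows "4 * (p*q - y*z) * (2 - (p+y+z+q) - W) \<le> W * (p+y+z+q)^2"
proof -
  define T where "T = p*q - y*z"
  define S where "S = p + y + z + q"
  define M where "M = 1 + 2*p - S"
  have M: "M > 0" and B: "2 - S - W > 0" using assms by (auto simp: M_def S_def)
  have "W * (Dy + Dz - D) \<le> W * q" using D assms by (intro mult_left_mono) auto
  then have 1: "(p - y) * (1 - p - y) + (p - z) * (1 - p - z) - (p - q) * (1 - p - q) \<le> W * q"
    using sty stz stq by (simp add: algebra_simps)
  \<comment> \<open>\<open>M\<close> is the factor that turns the combined left-hand sides into a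
    multiple of the linear part of the target, up to the product \<open>(p-y)*(p-z)\<close>. That
    product later gets the coefficient \<open>-(M - 2*p) = -(1 - S) \<le> 0\<close>.\<close>
  have "M * ((p-y) + (p-z) - (p-q)) - 2 * ((p-y)*(p-z))
     = (p - y) * (1 - p - y) + (p - z) * (1 - p - z) - (p - q) * (1 - p - q)"
    by (simp add: M_def S_def algebra_simps)
  with 1 have 2: "M * ((p-y) + (p-z) - (p-q)) \<le> W * q + 2 * ((p-y)*(p-z))" by linarith
  have T: "T = p * ((p-y) + (p-z) - (p-q)) - (p-y)*(p-z)"
    by (simp add: T_def algebra_simps)
  have "M * T = p * (M * ((p-y) + (p-z) - (p-q))) - M * ((p-y)*(p-z))"
    by (simp add: T algebra_simps)
  also have "\<dots> \<le> p * (W * q + 2 * ((p-y)*(p-z))) - M * ((p-y)*(p-z))"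
    using 2 assms by (intro diff_right_mono mult_left_mono) auto
  also have "\<dots> = W * p * q - (M - 2*p) * ((p-y)*(p-z))" by (simp add: algebra_simps)
  also have "\<dots> \<le> W * p * q"
    using assms by (simp add: M_def S_def)
  finally have MT: "M * T \<le> W * p * q" .
  have "M * (4 * T * (2 - S - W)) = 4 * (2 - S - W) * (M * T)" by (simp add: algebra_simps)
  also have "\<dots> \<le> 4 * (2 - S - W) * (W * p * q)"
    using B MT by (intro mult_left_mono) auto
  also have "\<dots> = W * (4 * p * q) * (2 - S - W)" by (simp add: algebra_simps)
  \<comment> \<open>The factor 3 produces the constant 12, exactly what the inequality of means
    allows in \<open>12 * p * q \<le> (p + 3*q)^2\<close>.\<close>
  also have "\<dots> \<le> W * (4 * p * q) * (3 * M)"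
    using assms by (intro mult_left_mono) (auto simp: M_def S_def)
  also have "\<dots> = W * M * (12 * p * q)" by simp
  also have "\<dots> \<le> W * M * S^2"
  proof (intro mult_left_mono)
    have "12 * p * q \<le> (p + 3*q)^2"
      using zero_le_power2[of "p - 3*q"] by (simp add: power2_eq_square algebra_simps)
    also have "\<dots> \<le> S^2" using assms by (intro power_mono) (auto simp: S_def)
    finally show "12 * p * q \<le> S^2" .
  qed (use M assms in auto)
  also have "\<dots> = M * (W * S^2)" by simp
  finally show ?thesis using M unfolding T_def S_def by simp
qed

section \<open>The gain of an exchange, and gaps\<close>

context compressed_clique
begin

text \<open>Moving to \<open>y\<close> costs \<open>s\<^sup>2 * B\<close> in \<open>E\<close>, but
  exchanging the two products improves by \<open>s * x t * S\<close> over doing so at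
  \<open>x\<close>. \<open>core\<close> says that for the best \<open>s\<close> the net gain covers
  the loss at \<open>x\<close>.\<close>

lemma exchange_gain:
  assumes x: "x \<in> weightings {1..t}"
    and opt: "\<And>y. y \<in> weightings {1..t} \<Longrightarrow> lagrange_poly E y \<le> lagrange_poly E x"
    and sorted: "\<And>i j. i \<in> {1..t} \<Longrightarrow> j \<in> {1..t} \<Longrightarrow> i < j \<Longrightarrow> x j \<le> x i"
    and ord: "1 \<le> i" "i < j" "j < k" "k < r" "r < t"
    and full: "\<And>l. l \<in> {1..<t} \<Longrightarrow> missing i l = 0"
    and miss: "missing j k = 1" "missing j r = 1" "missing k r = 1"
    and pos: "x t > 0"
    and core: "4 * (x i * x r - x j * x k) * (2 - (x i + x j + x k + x r) - x t)
       \<le> x t * (x i + x j + x k + x r)\<^sup>2"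
  shows "\<exists>y\<in>weightings {1..t}. lagrange_poly E x \<le> lagrange_poly E y - y i * y r * y t + y j * y k * y t"
proof -
  define S where "S = x i + x j + x k + x r"
  define B where "B = 2 - S - x t"
  define v :: "nat \<Rightarrow> real" where
    "v = (\<lambda>l. of_bool (l = j) + of_bool (l = k) - of_bool (l = r) - of_bool (l = i))"
  \<comment> \<open>the maximizer of \<open>s * x t * S - s\<^sup>2 * B\<close>\<close>
  define s where "s = x t * S / (2 * B)"
  have mem: "i \<in> {1..<t}" "j \<in> {1..<t}" "k \<in> {1..<t}" "r \<in> {1..<t}" using ord by auto
  have dist: "i \<noteq> j" "i \<noteq> k" "i \<noteq> r" "j \<noteq> k" "j \<noteq> r" "k \<noteq> r" using ord by auto
  have x1: "sum x {1..t} = 1" and x0: "\<And>l. l \<in> {1..t} \<Longrightarrow> 0 \<le> x l" using x by (auto simp: weightings_def)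
  have le: "x t \<le> x r" "x r \<le> x k" "x k \<le> x j" "x j \<le> x i"
    using sorted[of r t] sorted[of k r] sorted[of j k] sorted[of i j] ord by auto
  have "sum x {i,j,k,r,t} \<le> sum x {1..t}"
    using mem x0 by (intro sum_mono2) auto
  then have S1: "S + x t \<le> 1" using x1 dist ord by (simp add: S_def)
  have vf: "(\<Sum>l\<in>{1..<t}. v l * f l) = f j + f k - f r - f i" for f :: "nat \<Rightarrow> real"
    using mem by (simp add: v_def algebra_simps sum.distrib sum_subtractf)
  have v0: "sum v {1..<t} = 0" using vf[of "\<lambda>_. 1"] by simp
  have vt: "v t = 0" using ord by (auto simp: v_def)
  have "(v l)^3 = v l" for l using dist by (auto simp: v_def)
  then have v3: "(\<Sum>l\<in>{1..<t}. (v l)^3) = 0" using v0 by simp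
  have v: "v i = -1" "v j = 1" "v k = 1" "v r = -1" using dist by (auto simp: v_def)
  have "(v l)\<^sup>2 * c = v l * (v l * c)" for l c by (simp add: power2_eq_square)
  then have v2: "(\<Sum>l\<in>{1..<t}. (v l)\<^sup>2 * (x l - 1/2)) = S - 2"
    unfolding vf by (simp only: vf v) (simp add: S_def)
  have "(\<Sum>a\<in>{1..<t}. \<Sum>b\<in>{1..<t}. missing a b * v a * v b) = (\<Sum>a\<in>{1..<t}. v a * (\<Sum>b\<in>{1..<t}. v b * missing a b))"
    by (simp add: sum_distrib_left mult_ac)
  \<comment> \<open>The row of \<open>i\<close> vanishes; the pairs \<open>jk\<close>,
    \<open>jr\<close>, \<open>kr\<close> contribute \<open>2 * (1 - 1 - 1)\<close>.\<close>
  also have "\<dots> = -2"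
  proof -
    have "missing l l = 0" for l by (simp add: missing_def)
    moreover have "missing k j = 1" "missing r j = 1" "missing r k = 1"
      using miss missing_sym by metis+
    moreover have "missing j i = 0" "missing k i = 0" "missing r i = 0"
      using full mem missing_sym by metis+
    ultimately show ?thesis
      unfolding vf using full[OF mem(2)] full[OF mem(3)] full[OF mem(4)] miss by simp
  qed
  finally have vv: "(\<Sum>a\<in>{1..<t}. \<Sum>b\<in>{1..<t}. missing a b * v a * v b) = -2" .
  have "grad x l \<le> grad x l'" if "l \<in> {i,j,k,r}" "l' \<in> {i,j,k,r}" for l l'
    using grad_le_of_optimal[OF x opt, of l' l] that mem le pos by (cases "l = l'") auto
  then have "grad x j = grad x i" "grad x k = grad x i" "grad x r = grad x i"
    by (meson antisym insertCI)+
  then have vg: "(\<Sum>l\<in>{1..<t}. v l * grad x l) = 0" unfolding vf by simp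
  have B0: "B > 0" using S1 pos le by (simp add: B_def)
  have S0: "S > 0" using pos le by (simp add: S_def)
  have s0: "s \<ge> 0" using B0 S0 pos by (simp add: s_def)
  \<comment> \<open>\<open>S + x t \<le> 1\<close> forces \<open>B \<ge> 1\<close>, so
    \<open>S \<le> 2 * B\<close>. The resulting \<open>s \<le> x r \<le> x i\<close> keeps the
    shifted weights nonnegative.\<close>
  have "x t * S \<le> x r * (2 * B)"
    using S1 S0 pos le by (intro mult_mono) (auto simp: B_def)
  then have sr: "s \<le> x r" using B0 by (simp add: s_def divide_le_eq)
  define y where "y = (\<lambda>l. x l + s * v l)"
  have yv: "y i = x i - s" "y r = x r - s" "y j = x j + s" "y k = x k + s" "y t = x t"
    using dist ord by (auto simp: y_def v_def)
  have y: "y \<in> weightings {1..t}"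
  proof -
    have "0 \<le> y l" if "l \<in> {1..t}" for l
    proof (cases "l \<in> {i, r}")
      case True
      then show ?thesis using yv sr le by auto
    next
      case False
      then have "0 \<le> v l" by (simp add: v_def)
      then show ?thesis using x0[OF that] s0 by (simp add: y_def)
    qed
    moreover have "sum y {1..t} = 1"
      using x1 v0 vt by (simp add: y_def sum_split_last sum.distrib del: One_nat_def flip: sum_distrib_left)
    ultimately show ?thesis by (simp add: weightings_def)
  qed
  have Ey: "lagrange_poly E y = lagrange_poly E x - s\<^sup>2 * B"
    unfolding y_def lagrange_poly_expand[OF x1 v0 vt] vg v3 v2 vv by (simp add: B_def algebra_simps)
  have "0 \<le> x t * (x t * S\<^sup>2 - 4 * (x i * x r - x j * x k) * B)"
    using core pos by (simp add: S_def B_def)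
  also have "\<dots> = 4 * B * (x t * S * s - s\<^sup>2 * B - x t * (x i * x r - x j * x k))"
    using B0 by (simp add: s_def field_simps power2_eq_square)
  finally have "0 \<le> x t * S * s - s\<^sup>2 * B - x t * (x i * x r - x j * x k)"
    using B0 by (simp add: zero_le_mult_iff)
  then have "lagrange_poly E x \<le> lagrange_poly E y - y i * y r * y t + y j * y k * y t"
    unfolding Ey yv by (simp add: S_def algebra_simps)
  with y show ?thesis by blast
qed

lemma edge_mono:
  assumes "{u, v, w} \<in> E" "u \<noteq> v" "u \<noteq> w" "v \<noteq> w"
    "1 \<le> u'" "1 \<le> v'" "1 \<le> w'" "u' \<le> u" "v' \<le> v" "w' \<le> w" "u' \<noteq> v'" "u' \<noteq> w'" "v' \<noteq> w'"
  shows "{u', v', w'} \<in> E"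
proof -
  have "u \<le> t" "v \<le> t" "w \<le> t" using edgeD[OF assms(1)] by auto
  then show ?thesis
    using compressed[unfolded left_compressed_def, rule_format, of u v w u' v' w'] assms by auto
qed

text \<open>Only the missing pairs avoiding \<open>t - 1\<close>: the colex-initial graph has none of these.\<close>

definition gaps :: "nat set set" where
  "gaps = {h. h \<subseteq> {1..t-2} \<and> card h = 2 \<and> insert t h \<notin> E}"

lemma pair_in_gaps: "{u, v} \<in> gaps \<longleftrightarrow> u \<in> {1..t-2} \<and> v \<in> {1..t-2} \<and> u \<noteq> v \<and> {u, v, t} \<notin> E"
  by (auto simp: gaps_def card_2_iff doubleton_eq_iff insert_commute)

lemma finite_gaps: "finite gaps"
  by (rule finite_subset[of _ "Pow {1..t-2}"]) (auto simp: gaps_def)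

lemma gaps_mono:
  assumes "{u, v} \<in> gaps" "u \<le> u'" "v \<le> v'" "u' \<noteq> v'" "u' \<le> t-2" "v' \<le> t-2"
  shows "{u', v'} \<in> gaps"
proof -
  have uv: "1 \<le> u" "1 \<le> v" "u \<noteq> v" "u < t" "v < t" "{u, v, t} \<notin> E"
    using assms(1) t3 by (auto simp: pair_in_gaps)
  have "u' < t" "v' < t" using assms t3 by auto
  then have "{u', v', t} \<notin> E" using edge_mono[of u' v' t u v t] uv assms by auto
  then show ?thesis using uv assms by (auto simp: pair_in_gaps)
qed

end

section \<open>Switching a gap\<close>

locale exchange = compressed_clique +
  fixes b :: nat
  assumes b: "1 \<le> b" "b \<le> t - 2"
    and link: "\<And>l. l \<in> {1..t-2} \<Longrightarrow> {l, t-1, t} \<in> E \<longleftrightarrow> l \<le> b"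
    and gaps_ne: "gaps \<noteq> {}"
    and gaps_card: "3 * card gaps \<le> 2 * (t - 2 - b)"
begin

text \<open>With \<open>k\<close>, the lexicographically first gap. No other gap lies below it, so
  its insertion respects left-compression; \<open>k\<close> being the least partner of
  \<open>j\<close> also decides whether \<open>j\<close> lies in one gap or several.\<close>

definition j where "j = (LEAST l. \<exists>l'. {l, l'} \<in> gaps)"
definition k where "k = (LEAST l. {j, l} \<in> gaps)"

lemma jk_gap: "{j, k} \<in> gaps"
proof -
  obtain h where h: "h \<in> gaps" using gaps_ne by auto
  then obtain u v where "h = {u, v}" by (auto simp: gaps_def card_2_iff)
  with h have "\<exists>l l'. {l, l'} \<in> gaps" by auto
  then have "\<exists>l'. {j, l'} \<in> gaps" unfolding j_def by (rule LeastI_ex)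
  then show ?thesis unfolding k_def by (rule LeastI_ex)
qed

lemma j_least: "{l, l'} \<in> gaps \<Longrightarrow> j \<le> l"
  unfolding j_def by (rule Least_le) blast

lemma k_least: "{j, l} \<in> gaps \<Longrightarrow> k \<le> l"
  unfolding k_def by (rule Least_le)

lemma full_edge: "l \<le> b \<Longrightarrow> 1 \<le> l \<Longrightarrow> l' \<in> {1..<t} \<Longrightarrow> l \<noteq> l' \<Longrightarrow> {l, l', t} \<in> E"
  using edge_mono[of l "t-1" t l l' t] link[of l] b by auto

lemma order: "b < j" "j < k" "k \<le> t - 2"
proof -
  have "{j, k, t} \<notin> E" "j \<in> {1..t-2}" "k \<in> {1..t-2}" "j \<noteq> k" using jk_gap by (auto simp: pair_in_gaps)
  moreover have "j \<le> k" using jk_gap j_least[of k j] by (simp add: insert_commute)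
  moreover have "k \<in> {1..<t}" using \<open>k \<in> {1..t-2}\<close> t3 by auto
  ultimately show "b < j" "j < k" "k \<le> t - 2"
    using full_edge[of j k] by (auto simp: not_le[symmetric])
qed

lemma missing_last: "l \<in> {1..t-2} \<Longrightarrow> missing l (t-1) = of_bool (b < l)"
  using link[of l] t3 by (auto simp: missing_def)

lemma missing_gaps: "l \<in> {1..t-2} \<Longrightarrow> l' \<in> {1..t-2} \<Longrightarrow> missing l l' = of_bool ({l, l'} \<in> gaps)"
  by (auto simp: missing_def pair_in_gaps)

lemma interval_split: "{1..<t} = insert (t-1) {1..t-2}"
  using t3 by auto

text \<open>The partners missing with \<open>l\<close> are its gap partners, collected in
  \<open>X\<close>, and possibly \<open>t-1\<close>.\<close>

lemma sum_missing_le: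
  assumes l: "l \<in> {1..t-2}" and X: "X \<subseteq> {1..t-2}" "\<And>l'. {l, l'} \<in> gaps \<Longrightarrow> l' \<in> X"
    and nn: "\<And>l. l \<in> {1..t} \<Longrightarrow> 0 \<le> x l"
  shows "(\<Sum>l'\<in>{1..<t}. missing l l' * x l') \<le> x (t-1) + sum x X"
proof -
  have "(\<Sum>l'\<in>{1..<t}. missing l l' * x l')
      = missing l (t-1) * x (t-1) + (\<Sum>l'\<in>{1..t-2}. missing l l' * x l')"
    unfolding interval_split by (subst sum.insert) (use t3 in auto)
  moreover have "missing l (t-1) * x (t-1) \<le> x (t-1)"
    using nn[of "t-1"] t3 by (auto simp: missing_def)
  moreover have "(\<Sum>l'\<in>{1..t-2}. missing l l' * x l') = (\<Sum>l'\<in>X. missing l l' * x l')"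
    using X missing_gaps[OF l] by (intro sum.mono_neutral_right) auto
  moreover have "\<dots> \<le> sum x X"
  proof (rule sum_mono)
    fix l' assume "l' \<in> X"
    then have "l' \<in> {1..t-2}" using X(1) by blast
    then have "l' \<in> {1..t}" by auto
    from nn[OF this] show "missing l l' * x l' \<le> x l'" by (simp add: missing_def)
  qed
  ultimately show ?thesis by linarith
qed

lemma sum_missing_last:
  "(\<Sum>l'\<in>{1..<t}. missing (t-1) l' * x l') = sum x {b<..t-2}"
proof -
  have "(\<Sum>l'\<in>{1..<t}. missing (t-1) l' * x l') = (\<Sum>l'\<in>{1..t-2}. missing (t-1) l' * x l')"
    unfolding interval_split by (subst sum.insert) (use t3 in \<open>auto simp: missing_def\<close>)
  also have "\<dots> = (\<Sum>l'\<in>{1..t-2}. if b < l' then x l' else 0)"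
  proof (intro sum.cong refl)
    fix l' assume "l' \<in> {1..t-2}"
    from missing_last[OF this] show "missing (t-1) l' * x l' = (if b < l' then x l' else 0)"
      unfolding missing_sym[of "t-1"] by simp
  qed
  also have "\<dots> = sum x {b<..t-2}"
    by (subst sum.inter_filter[symmetric]) (auto intro!: sum.cong)
  finally show ?thesis .
qed

text \<open>Gaps are closed upwards, so every \<open>l\<close> from \<open>j\<close> on forms a gap
  with \<open>t-2\<close>, and with \<open>t-3\<close>, whenever it is smaller. These disjoint
  families have \<open>t-2-j\<close> and \<open>t-3-j\<close> members.\<close>

lemma gaps_many:
  assumes "k \<le> t - 3"
  shows "2 * (t - 1 - j) \<le> card gaps + 3"
proof -
  let ?A = "(\<lambda>l. {l, t-2}) ` {j..<t-2}" and ?B = "(\<lambda>l. {l, t-3}) ` {j..<t-3}"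
  have "?A \<union> ?B \<subseteq> gaps"
    using gaps_mono[OF jk_gap, of _ "t-2"] gaps_mono[OF jk_gap, of _ "t-3"] assms order by auto
  then have "card (?A \<union> ?B) \<le> card gaps" by (rule card_mono[OF finite_gaps])
  moreover have "card (?A \<union> ?B) = card ?A + card ?B"
    by (rule card_Un_disjoint) (auto simp: doubleton_eq_iff)
  moreover have "card ?A = t - 2 - j" by (subst card_image) (auto intro!: inj_onI simp: doubleton_eq_iff)
  moreover have "card ?B = t - 3 - j" by (subst card_image) (auto intro!: inj_onI simp: doubleton_eq_iff)
  ultimately show ?thesis using assms order by linarith
qed

text \<open>Supplies \<open>core\<close> of \<open>exchange_gain\<close> for \<open>i = b\<close>
  and \<open>r = t-1\<close>. Vertex \<open>b\<close> has no missing partner, so comparing its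
  derivative with those at \<open>j\<close>, \<open>k\<close>, \<open>t-1\<close> isolates
  \<open>x t * D l\<close>.\<close>

lemma exchange_condition:
  assumes x: "x \<in> weightings {1..t}"
    and opt: "\<And>y. y \<in> weightings {1..t} \<Longrightarrow> lagrange_poly E y \<le> lagrange_poly E x"
    and sorted: "\<And>i j. i \<in> {1..t} \<Longrightarrow> j \<in> {1..t} \<Longrightarrow> i < j \<Longrightarrow> x j \<le> x i"
    and pos: "x t > 0"
  shows "4 * (x b * x (t-1) - x j * x k) * (2 - (x b + x j + x k + x (t-1)) - x t)
       \<le> x t * (x b + x j + x k + x (t-1))\<^sup>2"
proof -
  define D where "D l = (\<Sum>l'\<in>{1..<t}. missing l l' * x l')" for l
  have x1: "sum x {1..t} = 1" and x0: "\<And>l. l \<in> {1..t} \<Longrightarrow> 0 \<le> x l" using x by (auto simp: weightings_def)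
  have le: "x t \<le> x (t-1)" "x (t-1) \<le> x k" "x k \<le> x j" "x j \<le> x b"
    using sorted[of "t-1" t] sorted[of k "t-1"] sorted[of j k] sorted[of b j] order b t3 by auto
  have S: "x b + x j + x k + x (t-1) + x t \<le> 1"
  proof -
    have "sum x {b,j,k,t-1,t} \<le> sum x {1..t}"
      using order b x0 by (intro sum_mono2) auto
    moreover have "distinct [b,j,k,t-1,t]" using order b t3 by auto
    ultimately show ?thesis using x1 by simp
  qed
  have g: "grad x l = (x l)\<^sup>2 - x l - x t * D l" for l by (simp add: grad_def D_def)
  have "D b = 0"
    unfolding D_def using full_edge[of b] b by (intro sum.neutral) (auto simp: missing_def)
  then have gb: "grad x b = (x b)\<^sup>2 - x b" by (simp add: g)
  have st: "(x b - x l) * (1 - x b - x l) = x t * D l" if "l \<in> {j, k, t-1}" for l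
  proof -
    have "grad x l = grad x b"
      using that order b t3 le pos
      by (intro antisym grad_le_of_optimal[OF x opt]) auto
    then show ?thesis unfolding gb unfolding g by (simp add: algebra_simps power2_eq_square)
  qed
  have jk: "j \<in> {1..t-2}" "k \<in> {1..t-2}" using order b by auto
  show ?thesis
  proof (cases "k = t - 2")
    \<comment> \<open>\<open>j\<close> lies in a single gap, so \<open>D j\<close> alone gives the bound\<close>
    case True
    have "l = k" if "{j, l} \<in> gaps" for l
      using k_least[OF that] that True by (auto simp: pair_in_gaps)
    then have "D j \<le> x (t-1) + sum x {k}"
      unfolding D_def using jk x0 by (intro sum_missing_le) auto
    then have "x t * D j \<le> x t * (x (t-1) + x k)" using pos by simp
    then show ?thesis
      using st[of j] le pos S by (intro exchange_ineq_one_gap) auto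
  next
    \<comment> \<open>both \<open>t - 2\<close> and \<open>t - 3\<close> form gaps with all smaller vertices from \<open>j\<close> on; this forces so many
      gaps, hence so many vertices in \<open>{b<..<j}\<close>, that \<open>D (t-1)\<close> is large\<close>
    case False
    then have k3: "k \<le> t - 3" using order by simp
    define n where "n = t - 1 - j"
    let ?N = "{j..t-2}"
    \<comment> \<open>There are at least \<open>2*n - 3\<close> gaps, and
      \<open>t-2-b = (j-b) + (n-1)\<close>. So \<open>gaps_card\<close> gives
      \<open>2*(j-b) \<ge> 4*n - 7\<close>, and integrality improves this to
      \<open>j-b \<ge> 2*n - 3\<close>.\<close>
    have n: "3 \<le> n" "2 * n - 4 \<le> j - 1 - b"
      using gaps_many[OF k3] gaps_card order k3 unfolding n_def by linarith+
    have N: "?N \<subseteq> {1..t-2}" "finite ?N" "j \<in> ?N" "k \<in> ?N" using order b by auto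
    have Dl: "D l \<le> x (t-1) + (sum x ?N - x l)" if "l \<in> {j,k}" for l
    proof -
      have "l \<in> ?N" using that N by auto
      have "l' \<in> ?N - {l}" if "{l, l'} \<in> gaps" for l'
        using j_least[of l' l] that by (auto simp: pair_in_gaps insert_commute)
      then have "D l \<le> x (t-1) + sum x (?N - {l})"
        unfolding D_def using jk that x0 N \<open>l \<in> ?N\<close> by (intro sum_missing_le) auto
      then show ?thesis using \<open>l \<in> ?N\<close> by (simp add: sum_diff1)
    qed
    have "sum x (?N - {j} - {k}) \<le> real (card (?N - {j} - {k})) * x j"
      using sorted[of j] order b by (intro sum_bounded_above) auto
    moreover have "sum x (?N - {j} - {k}) = sum x ?N - x j - x k"
      using N order by (simp add: sum_diff1)
    moreover have "card (?N - {j} - {k}) = n - 2"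
      using N order by (simp add: n_def)
    ultimately have 1: "sum x ?N - x j - x k \<le> real (n - 2) * x j" by simp
    have "real (card {b<..<j}) * x j \<le> sum x {b<..<j}"
      using sorted[of _ j] order b by (intro sum_bounded_below) auto
    moreover have "card {b<..<j} = j - 1 - b" by simp
    moreover have "real (2 * n - 4) * x j \<le> real (j - 1 - b) * x j"
      using n(2) le pos by (intro mult_right_mono) auto
    ultimately have 2: "real (2 * n - 4) * x j \<le> sum x {b<..<j}" by simp
    have "{b<..t-2} = {b<..<j} \<union> ?N" using order by auto
    moreover have "sum x ({b<..<j} \<union> ?N) = sum x {b<..<j} + sum x ?N"
      by (rule sum.union_disjoint) auto
    ultimately have "D (t-1) = sum x {b<..<j} + sum x ?N"
      unfolding D_def sum_missing_last by simp
    then have "D j + D k - D (t-1) \<le> 2 * x (t-1) + (sum x ?N - x j - x k) - sum x {b<..<j}"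
      using Dl[of j] Dl[of k] by simp
    also have "\<dots> \<le> 2 * x (t-1) + (real (n - 2) * x j - real (2 * n - 4) * x j)"
      using 1 2 by linarith
    also have "real (n - 2) * x j - real (2 * n - 4) * x j = - (real (n - 2) * x j)"
      using n by (simp add: of_nat_diff algebra_simps)
    finally have "D j + D k - D (t-1) \<le> 2 * x (t-1) - real (n - 2) * x j" by simp
    \<comment> \<open>As \<open>n \<ge> 3\<close>, this surplus absorbs one of the two copies of
      \<open>x (t-1)\<close>, leaving the bound \<open>q\<close> on
      \<open>Dy + Dz - D\<close>.\<close>
    moreover have "1 * x (t-1) \<le> real (n - 2) * x j" using n le pos by (intro mult_mono) auto
    ultimately have "D j + D k - D (t-1) \<le> x (t-1)" by simp
    then show ?thesis
      using st[of j] st[of k] st[of "t-1"] le pos S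
      by (intro exchange_ineq_many_gaps[where Dy = "D j" and Dz = "D k" and D = "D (t-1)"]) auto
  qed
qed

end

section \<open>The switched graph\<close>

lemma triple_eq_cases:
  assumes "{x, y, z} = {u, v, w}" "u \<noteq> v" "u \<noteq> w" "v \<noteq> w"
  obtains "x = u" "y = v" "z = w" | "x = u" "y = w" "z = v" | "x = v" "y = u" "z = w"
    | "x = v" "y = w" "z = u" | "x = w" "y = u" "z = v" | "x = w" "y = v" "z = u"
proof -
  have "x \<in> {u,v,w}" "y \<in> {u,v,w}" "z \<in> {u,v,w}" "u \<in> {x,y,z}" "v \<in> {x,y,z}" "w \<in> {x,y,z}"
    using assms(1) by auto
  then show thesis using that assms(2-4) by auto
qed

context exchange
begin

definition switched :: "nat set set" where
  "switched = insert {j, k, t} (E - {{b, t-1, t}})"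

lemma jk_nonedge: "{j, k, t} \<notin> E"
  using jk_gap by (simp add: pair_in_gaps)

lemma last_edge: "{b, t-1, t} \<in> E"
  using link[of b] b by simp

lemma card_switched: "card switched = card E"
proof -
  have "card E > 0" using last_edge finite_E by (auto simp: card_gt_0_iff)
  then show ?thesis
    using jk_nonedge last_edge finite_E by (simp add: switched_def card_Diff_singleton)
qed

lemma lagrange_poly_switched:
  "lagrange_poly switched y = lagrange_poly E y - y b * y (t-1) * y t + y j * y k * y t"
proof -
  have "lagrange_poly E y = (\<Prod>i\<in>{b,t-1,t}. y i) + lagrange_poly (E - {{b,t-1,t}}) y"
    unfolding lagrange_poly_def using finite_E last_edge by (rule sum.remove)
  moreover have "lagrange_poly switched y = (\<Prod>i\<in>{j,k,t}. y i) + lagrange_poly (E - {{b,t-1,t}}) y"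
    unfolding lagrange_poly_def switched_def using finite_E jk_nonedge by (intro sum.insert) auto
  moreover have "(\<Prod>i\<in>{b,t-1,t}. y i) = y b * y (t-1) * y t"
  proof -
    have "b \<noteq> t-1" "b \<noteq> t" "t-1 \<noteq> t" using b t3 by auto
    then show ?thesis by simp
  qed
  moreover have "(\<Prod>i\<in>{j,k,t}. y i) = y j * y k * y t"
  proof -
    have "j \<noteq> k" "j \<noteq> t" "k \<noteq> t" using order t3 by auto
    then show ?thesis by simp
  qed
  ultimately show ?thesis by simp
qed

text \<open>Makes \<open>{b, t-1, t}\<close> maximal among the edges in the componentwise order, so
  that no remaining edge requires it.\<close>

lemma edge_above_last:
  assumes "{u, v, w} \<in> E" "u \<noteq> v" "u \<noteq> w" "v \<noteq> w" "b \<le> u" "t - 1 \<le> v" "t \<le> w"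
  shows "{u, v, w} = {b, t-1, t}"
proof -
  have "u \<in> {1..t}" "v \<in> {1..t}" "w \<in> {1..t}" using edgeD[OF assms(1)] by auto
  then have *: "w = t" "v = t - 1" "u \<le> t - 2" using assms t3 by auto
  then have "u \<le> b" using link[of u] assms(1) \<open>u \<in> {1..t}\<close> by auto
  with * show ?thesis using assms by simp
qed

text \<open>By the choice of \<open>j\<close> and \<open>k\<close>, the only gap
  \<open>{u, v}\<close> with \<open>u \<le> j\<close> and \<open>v \<le> k\<close> is
  \<open>{j, k}\<close> itself. The deleted edge is not among these triples, since \<open>u\<close>
  and \<open>v\<close> are below \<open>t-1\<close>.\<close>

lemma switched_below_gap:
  assumes u: "u \<noteq> v" "u \<noteq> w" "v \<noteq> w" "1 \<le> u" "1 \<le> v" "1 \<le> w" "u \<le> j" "v \<le> k" "w \<le> t"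
  shows "{u, v, w} \<in> switched"
proof -
  have uv: "u \<in> {1..t-2}" "v \<in> {1..t-2}" using assms order by auto
  then have ne: "{u, v, w} \<noteq> {b, t-1, t}" using b t3 by (auto elim!: triple_eq_cases)
  show ?thesis
  proof (cases "w = t")
    case False
    then have "{u, v, w} \<subseteq> {1..<t}" using assms uv by auto
    then have "{u, v, w} \<in> E" using clique[of "{u, v, w}"] assms by simp
    with ne show ?thesis by (simp add: switched_def)
  next
    case True
    show ?thesis
    proof (cases "{u, v} \<in> gaps")
      case g: True
      then have "u = j" using j_least[of u v] assms by simp
      with g have "v = k" using k_least[of v] assms by simp
      with True \<open>u = j\<close> show ?thesis by (simp add: switched_def)
    next
      case False
      with True ne uv assms show ?thesis by (simp add: switched_def pair_in_gaps)
    qed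
  qed
qed

text \<open>A minimal nonedge enters and a maximal edge leaves. The six cases arise because
  \<open>left_compressed\<close> compares listed triples, and a set can be listed in six
  orders.\<close>

lemma left_compressed_switched: "left_compressed {1..t} switched"
  unfolding left_compressed_def
proof (intro allI impI, elim conjE)
  fix j1 j2 j3 i1 i2 i3
  assume J: "{j1, j2, j3} \<in> switched" "card {j1, j2, j3} = 3"
    and i: "i1 \<in> {1..t}" "i2 \<in> {1..t}" "i3 \<in> {1..t}" "i1 \<noteq> i2" "i1 \<noteq> i3" "i2 \<noteq> i3"
    and le: "i1 \<le> j1" "i2 \<le> j2" "i3 \<le> j3"
  have dj: "j1 \<noteq> j2" "j1 \<noteq> j3" "j2 \<noteq> j3" using J(2) by (auto simp: card_insert_if split: if_splits)
  have i1: "1 \<le> i1" "1 \<le> i2" "1 \<le> i3" "i1 \<le> t" "i2 \<le> t" "i3 \<le> t" using i by auto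
  show "{i1, i2, i3} \<in> switched"
  proof (cases "{j1, j2, j3} = {j, k, t}")
    case True
    have "j \<noteq> k" "j \<noteq> t" "k \<noteq> t" using order t3 by auto
    with True show ?thesis
    proof (cases rule: triple_eq_cases)
      case 1 then show ?thesis using switched_below_gap[of i1 i2 i3] i i1 le by simp
    next
      case 2 then show ?thesis using switched_below_gap[of i1 i3 i2] i i1 le by (simp add: insert_commute)
    next
      case 3 then show ?thesis using switched_below_gap[of i2 i1 i3] i i1 le by (simp add: insert_commute)
    next
      case 4 then show ?thesis using switched_below_gap[of i3 i1 i2] i i1 le by (simp add: insert_commute)
    next
      case 5 then show ?thesis using switched_below_gap[of i2 i3 i1] i i1 le by (simp add: insert_commute)
    next
      case 6 then show ?thesis using switched_below_gap[of i3 i2 i1] i i1 le by (simp add: insert_commute)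
    qed
  next
    case False
    then have JE: "{j1, j2, j3} \<in> E" "{j1, j2, j3} \<noteq> {b, t-1, t}" using J by (auto simp: switched_def)
    have "{i1, i2, i3} \<in> E" using edge_mono[OF JE(1) dj] i i1 le by simp
    moreover have "{i1, i2, i3} \<noteq> {b, t-1, t}"
    proof
      assume eq: "{i1, i2, i3} = {b, t-1, t}"
      have "b \<noteq> t-1" "b \<noteq> t" "t-1 \<noteq> t" using b t3 by auto
      with eq have "{j1, j2, j3} = {b, t-1, t}"
      proof (cases rule: triple_eq_cases)
        case 1 then show ?thesis using edge_above_last[of j1 j2 j3] JE dj le by simp
      next
        case 2 then show ?thesis using edge_above_last[of j1 j3 j2] JE dj le by (simp add: insert_commute)
      next
        case 3 then show ?thesis using edge_above_last[of j2 j1 j3] JE dj le by (simp add: insert_commute)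
      next
        case 4 then show ?thesis using edge_above_last[of j3 j1 j2] JE dj le by (simp add: insert_commute)
      next
        case 5 then show ?thesis using edge_above_last[of j2 j3 j1] JE dj le by (simp add: insert_commute)
      next
        case 6 then show ?thesis using edge_above_last[of j3 j2 j1] JE dj le by (simp add: insert_commute)
      qed
      with JE(2) show False by simp
    qed
    ultimately show ?thesis by (simp add: switched_def)
  qed
qed

lemma compressed_clique_switched: "compressed_clique t switched"
proof
  have jkt: "{j, k, t} \<subseteq> {1..t}" "card {j, k, t} = 3" using order t3 b by auto
  show "three_graph {1..t} switched"
    using graph jkt by (auto simp: three_graph_def switched_def)
  show "e \<in> switched" if "e \<subseteq> {1..<t}" "card e = 3" for e
    using clique[OF that] that(1) by (auto simp: switched_def)
qed (use t3 left_compressed_switched in auto)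

lemma link_switched:
  assumes l: "l \<in> {1..t-2}"
  shows "{l, t-1, t} \<in> switched \<longleftrightarrow> l \<le> b - 1"
proof -
  have "{l, t-1, t} \<noteq> {j, k, t}" using order l t3 by (auto elim!: triple_eq_cases)
  moreover have "{l, t-1, t} = {b, t-1, t} \<longleftrightarrow> l = b" using l b t3 by auto
  ultimately have "{l, t-1, t} \<in> switched \<longleftrightarrow> l \<le> b \<and> l \<noteq> b"
    using link[OF l] by (simp add: switched_def)
  then show ?thesis using b by auto
qed

text \<open>The deleted edge contains \<open>t-1\<close>, hence creates no gap.\<close>

lemma gaps_switched: "compressed_clique.gaps t switched = gaps - {{j, k}}"
proof -
  interpret S: compressed_clique t switched by (rule compressed_clique_switched)
  have "{u, v} \<in> S.gaps \<longleftrightarrow> {u, v} \<in> gaps \<and> {u, v} \<noteq> {j, k}" for u v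
  proof -
    have "{u, v, t} \<noteq> {b, t-1, t}" if "u \<in> {1..t-2}" "v \<in> {1..t-2}" 
      using that b t3 by (auto elim!: triple_eq_cases)
    moreover have "{u, v, t} = {j, k, t} \<longleftrightarrow> {u, v} = {j, k}" if "u \<in> {1..t-2}" "v \<in> {1..t-2}"
    proof -
      have "t \<notin> {u, v}" "t \<notin> {j, k}" using that order t3 by auto
      then have "insert t {u, v} = insert t {j, k} \<longleftrightarrow> {u, v} = {j, k}" by (rule insert_ident)
      then show ?thesis by (simp add: insert_commute)
    qed
    ultimately show ?thesis
      unfolding S.pair_in_gaps pair_in_gaps by (auto simp: switched_def)
  qed
  moreover have "\<exists>u v. h = {u, v}" if "h \<in> S.gaps \<union> gaps" for h
    using that by (auto simp: S.gaps_def gaps_def card_2_iff)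
  ultimately have "h \<in> S.gaps \<longleftrightarrow> h \<in> gaps \<and> h \<noteq> {j, k}" for h
    by (metis UnI1 UnI2)
  then show ?thesis by blast
qed

lemma lagrangian_switched: "lagrangian {1..t} E \<le> lagrangian {1..t} switched"
proof -
  have ne: "{1..t} \<noteq> {}" using t3 by simp
  have S: "three_graph {1..t} switched"
    using compressed_clique_switched by (simp add: compressed_clique_def)
  obtain x where x: "x \<in> weightings {1..t}"
      "\<And>y. y \<in> weightings {1..t} \<Longrightarrow> lagrange_poly E y \<le> lagrange_poly E x"
      "\<And>i j. i \<in> {1..t} \<Longrightarrow> j \<in> {1..t} \<Longrightarrow> i < j \<Longrightarrow> x j \<le> x i"
    using sorted_optimum_exists[OF graph compressed ne] by blast
  have Lx: "lagrangian {1..t} E \<le> lagrange_poly E x"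
    using lagrangian_attained[OF graph ne] x(2) by auto
  have "\<exists>y\<in>weightings {1..t}. lagrange_poly E x \<le> lagrange_poly switched y"
  proof (cases "x t = 0")
    \<comment> \<open>Both exchanged edges contain \<open>t\<close>, so the two polynomials agree at
      \<open>x\<close>.\<close>
    case True
    then show ?thesis using x(1) by (intro bexI[of _ x]) (simp_all add: lagrange_poly_switched)
  next
    case False
    then have pos: "x t > 0" using x(1) t3 by (auto simp: weightings_def order.strict_iff_order)
    have jk: "j \<in> {1..t-2}" "k \<in> {1..t-2}" using order b by auto
    have 1: "b < j" "j < k" "k < t-1" "t-1 < t" using order t3 by auto
    have 2: "missing b l = 0" if "l \<in> {1..<t}" for l
      using full_edge[of b l] that b by (auto simp: missing_def)
    have 3: "missing j k = 1" "missing j (t-1) = 1" "missing k (t-1) = 1"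
      using missing_gaps[OF jk] jk_gap missing_last[OF jk(1)] missing_last[OF jk(2)] 1 by simp_all
    show ?thesis
      unfolding lagrange_poly_switched
      by (rule exchange_gain[OF x b(1) 1 2 3 pos exchange_condition[OF x pos]])
  qed
  with Lx lagrangian_upper[OF S] show ?thesis by (meson order_trans)
qed

end

section \<open>Edge count and the colex initial segment\<close>

context compressed_clique
begin

text \<open>Edges are sorted by whether they avoid \<open>t\<close>, contain \<open>t\<close> but
  not \<open>t-1\<close>, or contain both; gaps are the pairs lost in the second class. Compared
  with the given edge number this yields \<open>b = a + card gaps\<close>.\<close>

lemma card_E:
  assumes b: "b \<le> t - 2" and link: "\<And>l. l \<in> {1..t-2} \<Longrightarrow> {l, t-1, t} \<in> E \<longleftrightarrow> l \<le> b"
  shows "card E + card gaps = ((t - 1) choose 3) + ((t - 2) choose 2) + b"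
proof -
  let ?A = "{e. e \<subseteq> {1..<t} \<and> card e = 3}"
  let ?P = "{h. h \<subseteq> {1..t-2} \<and> card h = 2}"
  let ?B = "insert t ` (?P - gaps)"
  let ?C = "(\<lambda>l. {l, t-1, t}) ` {1..b}"
  have finP: "finite ?P" by (rule finite_subset[of _ "Pow {1..t-2}"]) auto
  have "E = ?A \<union> ?B \<union> ?C"
  proof (intro equalityI subsetI)
    fix e assume e: "e \<in> E"
    then have eV: "e \<subseteq> {1..t}" "card e = 3" and fin: "finite e"
      using edgeD[OF e] by (auto intro: finite_subset)
    show "e \<in> ?A \<union> ?B \<union> ?C"
    proof (cases "t \<in> e")
      case False
      then have "e \<subseteq> {1..<t}" using eV(1) unfolding vertices_eq by blast
      then show ?thesis using eV by blast
    next
      case True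
      define h where "h = e - {t}"
      have h: "e = insert t h" "card h = 2" "h \<subseteq> {1..<t}"
        using True eV unfolding h_def vertices_eq by auto
      show ?thesis
      proof (cases "t - 1 \<in> h")
        case False
        then have "h \<subseteq> {1..t-2}"
        proof -
          have "{1..<t} = insert (t-1) {1..t-2}" using t3 by auto
          then show ?thesis using h(3) False by (metis subset_insert)
        qed
        then have "h \<in> ?P - gaps" using h e by (auto simp: gaps_def)
        then show ?thesis using h(1) by blast
      next
        case True
        then obtain l where l: "h = {l, t-1}" "l \<noteq> t-1"
          using h(2) by (auto simp: card_2_iff)
        then have "l \<in> {1..t-2}" "e = {l, t-1, t}" using h by auto
        then have "e \<in> ?C" using link e by auto
        then show ?thesis by blast
      qed
    qed
  next
    fix e assume "e \<in> ?A \<union> ?B \<union> ?C"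
    then consider "e \<in> ?A" | "e \<in> ?B" | "e \<in> ?C" by blast
    then show "e \<in> E"
    proof cases
      case 3
      then obtain l where "l \<in> {1..b}" "e = {l, t-1, t}" by blast
      then show ?thesis using link[of l] b by auto
    qed (use clique in \<open>auto simp: gaps_def\<close>)
  qed
  moreover have "card (?A \<union> ?B \<union> ?C) = card ?A + card ?B + card ?C"
  proof -
    have finA: "finite ?A" by (rule finite_subset[of _ "Pow {1..<t}"]) auto
    have disj: "A \<inter> B = {} \<and> (A \<union> B) \<inter> C = {}"
      if "\<And>e. e \<in> A \<Longrightarrow> t \<notin> e" "\<And>e. e \<in> B \<Longrightarrow> t \<in> e" "\<And>e. e \<in> C \<Longrightarrow> t \<in> e"
        "\<And>e. e \<in> B \<Longrightarrow> t - 1 \<notin> e" "\<And>e. e \<in> C \<Longrightarrow> t - 1 \<in> e" for A B C :: "nat set set"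
      unfolding disjoint_iff Un_iff using that by metis
    have "?A \<inter> ?B = {} \<and> (?A \<union> ?B) \<inter> ?C = {}"
    proof (rule disj)
      fix e assume "e \<in> ?B"
      then obtain h where h: "e = insert t h" "h \<in> ?P - gaps" by (rule imageE)
      moreover have "t - 1 \<notin> {1..t-2}" "t - 1 \<noteq> t" using t3 by auto
      ultimately show "t - 1 \<notin> e" by auto
    qed auto
    then show ?thesis using finA finP by (simp add: card_Un_disjoint)
  qed
  moreover have "card ?A = (t - 1) choose 3" using n_subsets[of "{1..<t}" 3] by simp
  moreover have "card ?B + card gaps = (t - 2) choose 2"
  proof -
    have "inj_on (insert t) (?P - gaps)"
    proof (rule inj_onI)
      fix g h assume "g \<in> ?P - gaps" "h \<in> ?P - gaps" "insert t g = insert t h"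
      moreover from this have "t \<notin> g" "t \<notin> h" using t3 by auto
      ultimately show "g = h" by (metis insert_ident)
    qed
    then have "card ?B = card (?P - gaps)" by (rule card_image)
    moreover have "card (?P - gaps) = card ?P - card gaps"
      by (rule card_Diff_subset[OF finite_gaps]) (auto simp: gaps_def)
    moreover have "card gaps \<le> card ?P"
      by (rule card_mono[OF finP]) (auto simp: gaps_def)
    moreover have "card ?P = (t - 2) choose 2" using n_subsets[of "{1..t-2}" 2] by simp
    ultimately show ?thesis by simp
  qed
  moreover have "card ?C = b"
  proof -
    have "inj_on (\<lambda>l. {l, t-1, t}) {1..b}"
    proof (rule inj_onI)
      fix l l' assume l: "l \<in> {1..b}" and "{l, t-1, t} = {l', t-1, t}"
      then have "l \<in> {l', t-1, t}" by blast
      then show "l = l'" using l b t3 by auto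
    qed
    then show ?thesis by (simp add: card_image)
  qed
  ultimately show ?thesis by simp
qed

text \<open>Matches \<open>{1..t}\<close> with \<open>colex_vertices\<close>, which is a union of
  edges.\<close>

lemma Union_edges:
  assumes "{1, t-1, t} \<in> E"
  shows "\<Union>E = {1..t}"
proof
  show "\<Union>E \<subseteq> {1..t}" using edgeD by blast
  show "{1..t} \<subseteq> \<Union>E"
  proof
    fix l assume l: "l \<in> {1..t}"
    show "l \<in> \<Union>E"
    proof (cases "l \<in> {1, t-1, t}")
      case False
      then have "{1, l, t-1} \<subseteq> {1..<t}" "card {1, l, t-1} = 3" using l t3 by auto
      then have "{1, l, t-1} \<in> E" by (rule clique)
      then show ?thesis by blast
    qed (use assms in blast)
  qed
qed

text \<open>Without gaps \<open>E\<close> is closed under colex predecessors. So each edge has fewer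
  than \<open>card E\<close> predecessors, which gives one inclusion, and equal cardinalities do the
  rest.\<close>

lemma colex_edges_eq:
  assumes "gaps = {}"
  shows "colex_edges (card E) = E"
proof -
  have triple: "e \<in> pos_triples" if "e \<in> E" for e using edgeD[OF that] by (auto simp: pos_triples_def)
  have closed: "B \<in> E" if A: "A \<in> E" and B: "B \<in> pos_triples" and less: "colex_less B A" for A B
  proof -
    have fin: "finite A" "finite B" and cA: "card A = 3" "A \<subseteq> {1..t}" and cB: "card B = 3" "B \<subseteq> {1..}"
      using edgeD[OF A] B by (auto simp: pos_triples_def intro: finite_subset card_ge_0_finite)
    define c where "c = Max (sym_diff B A)"
    have c: "c \<in> A" "c \<notin> B"
      using less Max_in[of "sym_diff B A"] fin by (auto simp: colex_less_def c_def)
    have above: "l \<in> B \<longleftrightarrow> l \<in> A" if "c < l" for l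
    proof -
      have "l \<notin> sym_diff B A"
        using that Max_ge[of "sym_diff B A" l] fin unfolding c_def by (meson finite_Diff finite_UnI not_le)
      then show ?thesis by blast
    qed
    have "c \<le> t" using c cA by auto
    have Bt: "B \<subseteq> {1..t}"
    proof
      fix l assume "l \<in> B"
      then show "l \<in> {1..t}" using above[of l] cA cB \<open>c \<le> t\<close> by (cases "c < l") auto
    qed
    show "B \<in> E"
    proof (cases "t \<in> B")
      case False
      then have "B \<subseteq> {1..<t}" using Bt unfolding vertices_eq by blast
      then show ?thesis using clique cB by blast
    next
      case True
      define h where "h = B - {t}"
      have h: "B = insert t h" "card h = 2" "h \<subseteq> {1..<t}"
        using True cB Bt unfolding h_def vertices_eq by auto
      have eq: "{1..<t} = insert (t-1) {1..t-2}" using t3 by auto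
      show ?thesis
      proof (cases "t - 1 \<in> h")
        case False
        then have "h \<subseteq> {1..t-2}" using h(3) unfolding eq by blast
        then show ?thesis using assms h(1,2) by (auto simp: gaps_def)
      next
        case t1: True
        then obtain l where l: "h = {l, t-1}" "l \<noteq> t-1"
          using h(2) by (auto simp: card_2_iff)
        have Beq: "B = {l, t-1, t}" "l \<in> {1..t-2}" using l h by auto
        \<comment> \<open>The largest difference \<open>c\<close> is outside \<open>B\<close>, hence
          below \<open>t-1\<close>. So \<open>A\<close> shares \<open>t-1\<close> and
          \<open>t\<close> with \<open>B\<close>, and the two triples differ only in their smallest
          elements, \<open>l < c\<close>.\<close>
        have "c \<noteq> t" "c \<noteq> t-1" using c(2) Beq by auto
        with \<open>c \<le> t\<close> have ct: "c < t-1" by auto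
        then have At: "t \<in> A" "t-1 \<in> A" using above[of t] above[of "t-1"] Beq by auto
        have "{c, t-1, t} \<subseteq> A" "card {c, t-1, t} = 3" using c At ct by auto
        then have Aeq: "A = {c, t-1, t}" using card_subset_eq[OF fin(1)] cA by metis
        have "l < c"
        proof (rule ccontr)
          assume "\<not> l < c"
          then have "c < l" using c Beq by (metis insertI1 nat_neq_iff)
          then have "l \<in> A" using above[of l] Beq by simp
          then show False using \<open>c < l\<close> Aeq Beq(2) t3 by auto
        qed
        then show ?thesis using edge_mono[of c "t-1" t l "t-1" t] A Aeq Beq ct by auto
      qed
    qed
  qed
  have "E \<subseteq> colex_edges (card E)"
  proof
    fix A assume A: "A \<in> E"
    have "{B \<in> pos_triples. colex_less B A} \<subset> E"
      using closed[OF A] A by (auto simp: colex_less_def)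
    then have "card {B \<in> pos_triples. colex_less B A} < card E"
      by (rule psubset_card_mono[OF finite_E])
    then show "A \<in> colex_edges (card E)" using triple[OF A] by (simp add: colex_edges_def)
  qed
  moreover have "finite (colex_edges (card E))"
    using card_colex_edges[of "card E"]
    by (cases "card E = 0") (auto simp: colex_edges_def intro: card_ge_0_finite)
  ultimately show ?thesis using card_colex_edges[of "card E"] card_subset_eq by metis
qed

end

section \<open>Induction on the number of gaps\<close>

text \<open>A switch lowers \<open>b\<close> and the number of gaps by one each, so the strict
  inequality between them persists, while the last hypothesis loses 3 on the left and gains 2 on the
  right. Strictness keeps \<open>b \<ge> 1\<close>: there is always an edge to delete, and in the
  end \<open>{1, t-1, t}\<close> is an edge.\<close>

lemma lagrangian_le_colex:
  assumes "compressed_clique t E"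
    and "\<And>l. l \<in> {1..t-2} \<Longrightarrow> {l, t-1, t} \<in> E \<longleftrightarrow> l \<le> b"
    and "b \<le> t - 2" "card (compressed_clique.gaps t E) < b"
    and "3 * card (compressed_clique.gaps t E) \<le> 2 * (t - 2 - b)"
  shows "lagrangian {1..t} E \<le> lagrangian (colex_vertices (card E)) (colex_edges (card E))"
  using assms
proof (induction "card (compressed_clique.gaps t E)" arbitrary: E b)
  case 0
  interpret compressed_clique t E by (rule 0)
  have "gaps = {}" using 0(1) finite_gaps by simp
  note eq = colex_edges_eq[OF this]
  have "{1, t-1, t} \<in> E" using 0(3)[of 1] 0(5) t3 by auto
  then show ?case unfolding colex_vertices_def eq by (simp add: Union_edges)
next
  case (Suc c)
  interpret compressed_clique t E by (rule Suc)
  have "gaps \<noteq> {}" "1 \<le> b" using Suc(2,6) by auto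
  then interpret exchange t E b
    using Suc(4,5,7) by unfold_locales
  have "card (gaps - {{j, k}}) = c" using jk_gap finite_gaps Suc(2) by simp
  then have c: "card (compressed_clique.gaps t switched) = c" by (simp add: gaps_switched)
  have "lagrangian {1..t} switched \<le> lagrangian (colex_vertices (card switched)) (colex_edges (card switched))"
  proof (rule Suc(1)[OF _ compressed_clique_switched, of "b - 1"])
    show "c = card (compressed_clique.gaps t switched)" using c ..
    show "b - 1 \<le> t - 2" "card (compressed_clique.gaps t switched) < b - 1"
        "3 * card (compressed_clique.gaps t switched) \<le> 2 * (t - 2 - (b - 1))"
      unfolding c using Suc(2,5,6,7) by linarith+
  qed (rule link_switched)
  then show ?case using lagrangian_switched by (simp add: card_switched)
qed

text \<open>Enumerating the clique increasingly by \<open>f\<close>, which skips the one vertex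
  \<open>w\<close> outside it, gives \<open>i \<le> f i\<close>. Left-compression then carries each
  triple of the clique down to \<open>{1..<t}\<close>.\<close>

lemma clique_initial:
  assumes graph: "three_graph {1..t} E" and lc: "left_compressed {1..t} E"
    and "has_clique {1..t} E (t - 1)" and e: "e \<subseteq> {1..<t}" "card e = 3"
  shows "e \<in> E"
proof -
  obtain S where S: "S \<subseteq> {1..t}" "card S = t - 1" "\<And>e. e \<subseteq> S \<Longrightarrow> card e = 3 \<Longrightarrow> e \<in> E"
    using assms(3) by (auto simp: has_clique_def)
  have "t \<ge> 1" using e by (cases t) auto
  have "card ({1..t} - S) = 1"
    using S(1,2) \<open>t \<ge> 1\<close> by (subst card_Diff_subset) (auto intro: finite_subset)
  then obtain w where w: "{1..t} - S = {w}" by (auto simp: card_1_singleton_iff)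
  define f where "f i = (if i < w then i else Suc i)" for i
  have f: "f i \<in> S" "i \<le> f i" if "i \<in> {1..<t}" for i
  proof -
    have "f i \<in> {1..t}" "f i \<noteq> w" using that by (auto simp: f_def)
    then show "f i \<in> S" using w by blast
  qed (simp add: f_def)
  have inj: "f i \<noteq> f i'" if "i \<noteq> i'" for i i' using that by (auto simp: f_def)
  obtain x y z where xyz: "e = {x, y, z}" "x \<noteq> y" "x \<noteq> z" "y \<noteq> z"
    using e(2) by (auto simp: card_3_iff)
  have m: "x \<in> {1..<t}" "y \<in> {1..<t}" "z \<in> {1..<t}" using e xyz by auto
  have c: "card {f x, f y, f z} = 3" using inj xyz by auto
  have "{f x, f y, f z} \<in> E" using f m c by (intro S(3)) auto
  then show ?thesis
    using lc[unfolded left_compressed_def, rule_format, of "f x" "f y" "f z" x y z] c f m xyz by auto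
qed

theorem theorem7:
  fixes m t a :: nat and E :: "nat set set"
  assumes "m > 0" and "t > 0"
    and "1 \<le> a" and "a \<le> t - 2"
    and "m = ((t - 1) choose 3) + ((t - 2) choose 2) + a"
    and "three_graph {1..t} E"
    and "left_compressed {1..t} E"
    and "card E = m"
    and "real (card (pair_link {1..t} E (t - 1) t)) \<le> (2 * real t + 3 * real a - 4) / 5"
    and "has_clique {1..t} E (t - 1)"
  shows "lagrangian {1..t} E \<le> lagrangian (colex_vertices m) (colex_edges m)"
proof -
  interpret compressed_clique t E
    using assms(3,4,6,7) clique_initial[OF assms(6,7,10)] by unfold_locales auto
  let ?L = "pair_link {1..t} E (t - 1) t"
  define b where "b = card ?L"
  have L: "l \<in> ?L \<longleftrightarrow> l \<in> {1..t-2} \<and> {l, t-1, t} \<in> E" for l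
  proof -
    have "l \<in> {1..t-2}" if "l \<in> {1..t}" "{t-1, t, l} \<in> E"
    proof -
      have "card {t-1, t, l} = 3" using edgeD[OF that(2)] by simp
      then have "l \<noteq> t" "l \<noteq> t - 1" by (auto simp: card_insert_if split: if_splits)
      then show ?thesis using that by auto
    qed
    then show ?thesis by (auto simp: pair_link_def insert_commute)
  qed
  have down: "l' \<in> ?L" if "l \<in> ?L" "1 \<le> l'" "l' \<le> l" for l l'
    using that edge_mono[of l "t-1" t l' "t-1" t] t3 unfolding L by auto
  \<comment> \<open>A link closed downwards is an initial segment, so its size alone determines
    it.\<close>
  have Lb: "?L = {1..b}"
  proof (cases "?L = {}")
    case False
    have fin: "finite ?L" by (simp add: pair_link_def)
    have "?L = {1..Max ?L}"
    proof (intro equalityI subsetI)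
      show "l \<in> {1..Max ?L}" if "l \<in> ?L" for l using that Max_ge[OF fin that] L by auto
      show "l \<in> ?L" if "l \<in> {1..Max ?L}" for l using that down[OF Max_in[OF fin False]] by auto
    qed
    then have "b = Max ?L" unfolding b_def by (metis card_atLeastAtMost diff_Suc_1)
    then show ?thesis using \<open>?L = {1..Max ?L}\<close> by simp
  qed (simp add: b_def)
  have link: "{l, t-1, t} \<in> E \<longleftrightarrow> l \<le> b" if "l \<in> {1..t-2}" for l
    using L[of l] that unfolding Lb by auto
  have "{1..b} \<subseteq> {1..t-2}" using L Lb by blast
  then have b2: "b \<le> t - 2" by (cases "b = 0") auto
  \<comment> \<open>Substituting \<open>a = b - card gaps\<close> in
    \<open>5*b + 4 \<le> 2*t + 3*a\<close> gives the bound
    \<open>3 * card gaps \<le> 2 * (t-2-b)\<close>, and \<open>a \<ge> 1\<close> gives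
    \<open>card gaps < b\<close>.\<close>
  have "b = a + card gaps" using card_E[OF b2 link] assms(5,8) by simp
  moreover have "5 * real b + 4 \<le> 2 * real t + 3 * real a"
    using assms(9) unfolding b_def by (simp add: field_simps)
  then have "5 * b + 4 \<le> 2 * t + 3 * a" by linarith
  ultimately show ?thesis
    using lagrangian_le_colex[OF compressed_clique_axioms link b2] assms(3,8) b2 by simp
qed

end
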